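(* There is a constant $C>0$ such that the following holds. Let $\epsilon\in(0,1)$, let $\ell,q\ge0$ be integers, and let $\mathcal B=(\mathcal L,\mathcal Q)$ be a quadratic factor on $G=\mathbb{F}_p^n$ of complexity $(\ell,q)$ and rank at least $C(\ell+q+\log_p(\epsilon^{-1}))$. For any $b\in\mathbb{F}_p^\ell\times\mathbb{F}_p^q$, any $d\in(\mathbb{F}_p^\ell\times\mathbb{F}_p^q)^3\times(\mathbb{F}_p^q)^3$ with $\Sigma(d)=b$, and any $f:G\to[-1,1]$, $$\big(\|f\|^{TW}_{U^3(d)}\big)^8=\big(\|f\|^{P}_{U^3(b)}\big)^8\pm\epsilon .$$
   Context: $p$ is an odd prime; $r=s\pm\epsilon$ means $|r-s|\le\epsilon$. Quadratic factors: For $\ell\ge1$, a linear factor of complexity $\ell$ on $\mathbb{F}_p^n$ is a linearly independent set $\mathcal{L}=\{r_1,\dots,r_\ell\}\subseteq\mathbb{F}_p^n$ (with a fixed enumeration); the linear factor of complexity $0$ is $\emptyset$. Put $\beta_{\mathcal L}(x)=(x\cdot r_1,\dots,x\cdot r_\ell)\in\mathbb{F}_p^\ell$ (the zero map to $\mathbb{F}_p^0$ if $\ell=0$) and $L(a)=\beta_{\mathcal L}^{-1}(a)$. For $q\ge 1$, a purely quadratic factor of complexity $q$ is a set $\mathcal{Q}=\{M_1,\dots,M_q\}$ of pairwise distinct symmetric $n\times n$ matrices over $\mathbb{F}_p$ (the empty set if $q=0$); put $\beta_{\mathcal Q}(x,y)=(x^TM_1y,\dots,x^TM_qy)\in\mathbb{F}_p^q$.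 The rank of $\mathcal Q$ is $n$ if $q=0$, and otherwise the minimum of $\mathrm{rk}(\lambda_1M_1+\dots+\lambda_qM_q)$ over $(\lambda_1,\dots,\lambda_q)\neq 0$. A quadratic factor of complexity $(\ell,q)$ is a pair $\mathcal{B}=(\mathcal L,\mathcal Q)$ of these; its rank is the rank of $\mathcal Q$; $\beta_{\mathcal B}(x)=(\beta_{\mathcal L}(x),\beta_{\mathcal Q}(x,x))$; its atoms are the sets $B(a,b)=\beta_{\mathcal B}^{-1}(a,b)$ for $(a,b)\in\mathbb{F}_p^\ell\times\mathbb{F}_p^q$. $U^3$ norm: for $f:G\to[-1,1]$, $\|f\|_{U^3}^8=\sum_{x,h_1,h_2,h_3\in G}\prod_{\omega\in\{0,1\}^3}f(x+\omega_1h_1+\omega_2h_2+\omega_3h_3)$. Prendiville local norm: for $b\in\mathbb{F}_p^\ell\times\mathbb{F}_p^q$, $\|f\|^P_{U^3(b)}=\|f1_{B(b)}\|_{U^3}/\|1_{B(b)}\|_{U^3}$ if $\|f1_{B(b)}\|_{U^3}\ne0$, and $0$ otherwise. $\Sigma$: for $d=(d_a,d_b,d_c,d_{ab},d_{ac},d_{bc})$ with $d_a,d_b,d_c\in\mathbb{F}_p^\ell\times\mathbb{F}_p^q$ and $d_{ab},d_{ac},d_{bc}\in\mathbb{F}_p^q$, $\Sigma(d)=d_a+d_b+d_c+2(0,d_{ab})+2(0,d_{ac})+2(0,d_{bc})\in\mathbb{F}_p^\ell\times\mathbb{F}_p^q$, where $(0,u)$ prepends $\ell$ zeros. For $\Gamma\subseteq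 G^2$, $\mu_\Gamma=\frac{|G|^2}{|\Gamma|}1_\Gamma$. Terry–Wolf local norm: for such $d$, $\big(\|f\|^{TW}_{U^3(d)}\big)^8=\mathbb{E}_{x_1,x_2\in B(d_a)}\mathbb{E}_{y_1,y_2\in B(d_b)}\mathbb{E}_{z_1,z_2\in B(d_c)}\prod_{(i,j)\in[2]^2}\mu_{\beta_{\mathcal Q}^{-1}(d_{ab})}(x_i,y_j)\mu_{\beta_{\mathcal Q}^{-1}(d_{ac})}(x_i,z_j)\mu_{\beta_{\mathcal Q}^{-1}(d_{bc})}(y_i,z_j)\prod_{(i,j,k)\in[2]^3}f(x_i+y_j+z_k)$. *)

theory Defs
  imports Complex_Main "HOL-Library.Indicator_Function" "HOL-Computational_Algebra.Primes"
begin

text \<open>Explicit model of F_p^n: vectors are functions nat => int with entries in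
  {0..<p} at indices < n and 0 elsewhere. Arithmetic is done modulo p.
  The prime p and the dimension n are ordinary variables (not types), so that the
  constant C in the main theorem can be chosen uniformly in p and n.\<close>

definition Vn :: "nat \<Rightarrow> nat \<Rightarrow> (nat \<Rightarrow> int) set" where
  "Vn p n = {x. (\<forall>i<n. 0 \<le> x i \<and> x i < int p) \<and> (\<forall>i. n \<le> i \<longrightarrow> x i = 0)}"

definition vadd :: "nat \<Rightarrow> (nat \<Rightarrow> int) \<Rightarrow> (nat \<Rightarrow> int) \<Rightarrow> (nat \<Rightarrow> int)" where
  "vadd p x y = (\<lambda>i. (x i + y i) mod int p)"

definition smul :: "nat \<Rightarrow> int \<Rightarrow> (nat \<Rightarrow> int) \<Rightarrow> (nat \<Rightarrow> int)" where
  "smul p c x = (\<lambda>i. (c * x i) mod int p)"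

definition dotp :: "nat \<Rightarrow> nat \<Rightarrow> (nat \<Rightarrow> int) \<Rightarrow> (nat \<Rightarrow> int) \<Rightarrow> int" where
  "dotp p n x y = (\<Sum>i<n. x i * y i) mod int p"

definition bilin :: "nat \<Rightarrow> nat \<Rightarrow> (nat \<Rightarrow> nat \<Rightarrow> int) \<Rightarrow> (nat \<Rightarrow> int) \<Rightarrow> (nat \<Rightarrow> int) \<Rightarrow> int" where
  "bilin p n M x y = (\<Sum>i<n. \<Sum>j<n. x i * M i j * y j) mod int p"

definition lin_indep_list :: "nat \<Rightarrow> nat \<Rightarrow> (nat \<Rightarrow> int) list \<Rightarrow> bool" where
  "lin_indep_list p n rs =
     (\<forall>c::nat \<Rightarrow> int. (\<forall>i<n. (\<Sum>k<length rs. c k * (rs!k) i) mod int p = 0)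
        \<longrightarrow> (\<forall>k<length rs. c k mod int p = 0))"

definition is_linear_factor :: "nat \<Rightarrow> nat \<Rightarrow> (nat \<Rightarrow> int) list \<Rightarrow> bool" where
  "is_linear_factor p n rs = (set rs \<subseteq> Vn p n \<and> lin_indep_list p n rs)"

definition Matn :: "nat \<Rightarrow> nat \<Rightarrow> (nat \<Rightarrow> nat \<Rightarrow> int) set" where
  "Matn p n = {M. (\<forall>i<n. \<forall>j<n. 0 \<le> M i j \<and> M i j < int p) \<and>
                  (\<forall>i j. n \<le> i \<or> n \<le> j \<longrightarrow> M i j = 0)}"

definition symm_mat :: "nat \<Rightarrow> (nat \<Rightarrow> nat \<Rightarrow> int) \<Rightarrow> bool" where
  "symm_mat n M = (\<forall>i<n. \<forall>j<n. M i j = M j i)"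

definition is_pquad_factor :: "nat \<Rightarrow> nat \<Rightarrow> (nat \<Rightarrow> nat \<Rightarrow> int) list \<Rightarrow> bool" where
  "is_pquad_factor p n Ms = (set Ms \<subseteq> Matn p n \<and> (\<forall>M\<in>set Ms. symm_mat n M) \<and> distinct Ms)"

definition cols_indep :: "nat \<Rightarrow> nat \<Rightarrow> (nat \<Rightarrow> nat \<Rightarrow> int) \<Rightarrow> nat set \<Rightarrow> bool" where
  "cols_indep p n A S =
     (\<forall>c::nat \<Rightarrow> int. (\<forall>i<n. (\<Sum>j\<in>S. A i j * c j) mod int p = 0) \<longrightarrow> (\<forall>j\<in>S. c j mod int p = 0))"

definition mat_rank :: "nat \<Rightarrow> nat \<Rightarrow> (nat \<Rightarrow> nat \<Rightarrow> int) \<Rightarrow> nat" where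
  "mat_rank p n A = Max {card S | S. S \<subseteq> {..<n} \<and> cols_indep p n A S}"

definition qf_rank :: "nat \<Rightarrow> nat \<Rightarrow> (nat \<Rightarrow> nat \<Rightarrow> int) list \<Rightarrow> nat" where
  "qf_rank p n Ms =
     (if Ms = [] then n
      else Min {mat_rank p n (\<lambda>i j. \<Sum>k<length Ms. lam k * (Ms!k) i j) | lam.
                  (\<forall>k<length Ms. 0 \<le> lam k \<and> lam k < int p) \<and> (\<exists>k<length Ms. lam k \<noteq> 0)})"

text \<open>Elements of F_p^l x F_p^q are pairs of vectors (in Vn p l \<times> Vn p q).\<close>
definition beta_L :: "nat \<Rightarrow> nat \<Rightarrow> (nat \<Rightarrow> int) list \<Rightarrow> (nat \<Rightarrow> int) \<Rightarrow> (nat \<Rightarrow> int)" where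
  "beta_L p n rs x = (\<lambda>k. if k < length rs then dotp p n x (rs!k) else 0)"

definition beta_Q :: "nat \<Rightarrow> nat \<Rightarrow> (nat \<Rightarrow> nat \<Rightarrow> int) list \<Rightarrow> (nat \<Rightarrow> int) \<Rightarrow> (nat \<Rightarrow> int) \<Rightarrow> (nat \<Rightarrow> int)" where
  "beta_Q p n Ms x y = (\<lambda>k. if k < length Ms then bilin p n (Ms!k) x y else 0)"

definition beta_B :: "nat \<Rightarrow> nat \<Rightarrow> (nat \<Rightarrow> int) list \<Rightarrow> (nat \<Rightarrow> nat \<Rightarrow> int) list
    \<Rightarrow> (nat \<Rightarrow> int) \<Rightarrow> (nat \<Rightarrow> int) \<times> (nat \<Rightarrow> int)" where
  "beta_B p n rs Ms x = (beta_L p n rs x, beta_Q p n Ms x x)"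

definition atom :: "nat \<Rightarrow> nat \<Rightarrow> (nat \<Rightarrow> int) list \<Rightarrow> (nat \<Rightarrow> nat \<Rightarrow> int) list
    \<Rightarrow> (nat \<Rightarrow> int) \<times> (nat \<Rightarrow> int) \<Rightarrow> (nat \<Rightarrow> int) set" where
  "atom p n rs Ms b = {x \<in> Vn p n. beta_B p n rs Ms x = b}"

definition u3_sum :: "nat \<Rightarrow> nat \<Rightarrow> ((nat \<Rightarrow> int) \<Rightarrow> real) \<Rightarrow> real" where
  "u3_sum p n f =
     (\<Sum>x\<in>Vn p n. \<Sum>h1\<in>Vn p n. \<Sum>h2\<in>Vn p n. \<Sum>h3\<in>Vn p n.
        \<Prod>w1\<in>{0,1::int}. \<Prod>w2\<in>{0,1::int}. \<Prod>w3\<in>{0,1::int}.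
          f (vadd p (vadd p (vadd p x (smul p w1 h1)) (smul p w2 h2)) (smul p w3 h3)))"

definition u3_norm :: "nat \<Rightarrow> nat \<Rightarrow> ((nat \<Rightarrow> int) \<Rightarrow> real) \<Rightarrow> real" where
  "u3_norm p n f = root 8 (u3_sum p n f)"

definition prend_norm :: "nat \<Rightarrow> nat \<Rightarrow> (nat \<Rightarrow> int) list \<Rightarrow> (nat \<Rightarrow> nat \<Rightarrow> int) list
    \<Rightarrow> ((nat \<Rightarrow> int) \<Rightarrow> real) \<Rightarrow> (nat \<Rightarrow> int) \<times> (nat \<Rightarrow> int) \<Rightarrow> real" where
  "prend_norm p n rs Ms f b =
     (let B = atom p n rs Ms b; fB = (\<lambda>x. f x * indicator B x) in
      if u3_norm p n fB \<noteq> 0 then u3_norm p n fB / u3_norm p n (indicator B) else 0)"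

definition padd :: "nat \<Rightarrow> (nat \<Rightarrow> int) \<times> (nat \<Rightarrow> int) \<Rightarrow> (nat \<Rightarrow> int) \<times> (nat \<Rightarrow> int)
    \<Rightarrow> (nat \<Rightarrow> int) \<times> (nat \<Rightarrow> int)" where
  "padd p u v = (vadd p (fst u) (fst v), vadd p (snd u) (snd v))"

definition Sigma_d :: "nat \<Rightarrow> (nat \<Rightarrow> int) \<times> (nat \<Rightarrow> int) \<Rightarrow> (nat \<Rightarrow> int) \<times> (nat \<Rightarrow> int)
    \<Rightarrow> (nat \<Rightarrow> int) \<times> (nat \<Rightarrow> int) \<Rightarrow> (nat \<Rightarrow> int) \<Rightarrow> (nat \<Rightarrow> int) \<Rightarrow> (nat \<Rightarrow> int)
    \<Rightarrow> (nat \<Rightarrow> int) \<times> (nat \<Rightarrow> int)" where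
  "Sigma_d p da db dc dab dac dbc =
     padd p (padd p (padd p (padd p (padd p da db) dc)
       (\<lambda>_. 0, smul p 2 dab)) (\<lambda>_. 0, smul p 2 dac)) (\<lambda>_. 0, smul p 2 dbc)"

definition qpre :: "nat \<Rightarrow> nat \<Rightarrow> (nat \<Rightarrow> nat \<Rightarrow> int) list \<Rightarrow> (nat \<Rightarrow> int)
    \<Rightarrow> ((nat \<Rightarrow> int) \<times> (nat \<Rightarrow> int)) set" where
  "qpre p n Ms u = {(x, y). x \<in> Vn p n \<and> y \<in> Vn p n \<and> beta_Q p n Ms x y = u}"

definition mu :: "nat \<Rightarrow> nat \<Rightarrow> ((nat \<Rightarrow> int) \<times> (nat \<Rightarrow> int)) set
    \<Rightarrow> (nat \<Rightarrow> int) \<Rightarrow> (nat \<Rightarrow> int) \<Rightarrow> real" where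
  "mu p n \<Gamma> x y = real (card (Vn p n)) ^ 2 / real (card \<Gamma>) * indicator \<Gamma> (x, y)"

text \<open>8th power of the Terry--Wolf local norm (this is how it is defined).\<close>
definition tw_norm8 :: "nat \<Rightarrow> nat \<Rightarrow> (nat \<Rightarrow> int) list \<Rightarrow> (nat \<Rightarrow> nat \<Rightarrow> int) list
    \<Rightarrow> ((nat \<Rightarrow> int) \<Rightarrow> real)
    \<Rightarrow> (nat \<Rightarrow> int) \<times> (nat \<Rightarrow> int) \<Rightarrow> (nat \<Rightarrow> int) \<times> (nat \<Rightarrow> int) \<Rightarrow> (nat \<Rightarrow> int) \<times> (nat \<Rightarrow> int)
    \<Rightarrow> (nat \<Rightarrow> int) \<Rightarrow> (nat \<Rightarrow> int) \<Rightarrow> (nat \<Rightarrow> int) \<Rightarrow> real" where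
  "tw_norm8 p n rs Ms f da db dc dab dac dbc =
     (let A = atom p n rs Ms da; B = atom p n rs Ms db; D = atom p n rs Ms dc;
          Gab = qpre p n Ms dab; Gac = qpre p n Ms dac; Gbc = qpre p n Ms dbc in
      (\<Sum>x1\<in>A. \<Sum>x2\<in>A. \<Sum>y1\<in>B. \<Sum>y2\<in>B. \<Sum>z1\<in>D. \<Sum>z2\<in>D.
         let X = (\<lambda>i::nat. if i = 1 then x1 else x2);
             Y = (\<lambda>i::nat. if i = 1 then y1 else y2);
             Z = (\<lambda>i::nat. if i = 1 then z1 else z2) in
         (\<Prod>i\<in>{1,2}. \<Prod>j\<in>{1,2}.
             mu p n Gab (X i) (Y j) * mu p n Gac (X i) (Z j) * mu p n Gbc (Y i) (Z j)) *
         (\<Prod>i\<in>{1,2}. \<Prod>j\<in>{1,2}. \<Prod>k\<in>{1,2}. f (vadd p (vadd p (X i) (Y j)) (Z k))))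
      / (real (card A) ^ 2 * real (card B) ^ 2 * real (card D) ^ 2))"

end

theory Submission
  imports Defs "HOL-Library.Function_Algebras"
begin

text \<open>
  In the Terry--Wolf average substitute \<open>x = x1 + y1 + z1\<close>, \<open>h1 = x2 - x1\<close>, \<open>h2 = y2 - y1\<close>,
  \<open>h3 = z2 - z1\<close>. The product of the values of \<open>f\<close> then depends only on the parallelepiped
  \<open>(x, h1, h2, h3)\<close>, which lies in the atom of \<open>b\<close> because \<open>\<Sigma>(d) = b\<close>, so the average is a sum over
  the parallelepipeds of the Prendiville norm, each weighted by the number of pairs \<open>(x1, y1)\<close>
  compatible with it. Once \<open>x, h1, h2, h3\<close> are fixed, exactly \<open>2 l + 11 q\<close> independent conditions on
  \<open>(x1, y1)\<close> remain. Large rank forces this weight to be nearly constant for most parallelepipeds: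
  in its Fourier expansion a nontrivial frequency with a quadratic part is small by a Gauss sum
  bound, and one without a quadratic part vanishes unless a linear relation holds among
  \<open>r\<^sub>k\<close>, \<open>M\<^sub>k x\<close>, \<open>M\<^sub>k h\<^sub>i\<close>, which is rare on average. The same estimate gives the sizes
  of the normalising factors.
\<close>

section \<open>Additive characters on vectors modulo p\<close>

text \<open>The conditions imposed in the Terry-Wolf average number \<open>6 l + 18 q\<close>: six
  points in atoms and twelve prescribed pairings. A parallelepiped in the atom of \<open>b\<close>
  accounts for \<open>4 l + 7 q\<close> of them and the pair \<open>(x1, y1)\<close> for the
  remaining \<open>2 l + 11 q\<close>. Because these add up with nothing left over, the main terms
  of the two norms agree exactly and only deviations of counts have to be estimated. The obstacle is
  that the weight of a parallelepiped is not uniformly close to its mean: at \<open>x = 0\<close>,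
  say, a condition on the pairing of \<open>x1\<close> with \<open>x\<close> no longer depends on
  \<open>x1\<close>. So the deviation is controlled in L1 over all \<open>(x, h1, h2, h3)\<close>,
  which is enough because the product of the values of \<open>f\<close> is bounded by 1. For this, a
  count must be compared with its mean by an error term that does not see the target values and can
  be summed over the vectors chosen before.\<close>

definition Vset :: "nat \<Rightarrow> 'i set \<Rightarrow> ('i \<Rightarrow> int) set" where
  "Vset p I = {x. (\<forall>i\<in>I. 0 \<le> x i \<and> x i < int p) \<and> (\<forall>i. i \<notin> I \<longrightarrow> x i = 0)}"

lemma Vn_eq_Vset: "Vn p n = Vset p {..<n}"
  by (auto simp: Vn_def Vset_def not_less)

lemma Vset_empty: "Vset p {} = {\<lambda>_. 0}"
  by (auto simp: Vset_def)

lemma sum_Vset_insert: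
  assumes "i \<notin> I"
  shows "(\<Sum>x\<in>Vset p (insert i I). F x) = (\<Sum>t\<in>{0..<int p}. \<Sum>x\<in>Vset p I. F (x(i := t)))"
proof -
  have "(\<Sum>t\<in>{0..<int p}. \<Sum>x\<in>Vset p I. F (x(i := t)))
      = (\<Sum>(t, x)\<in>{0..<int p} \<times> Vset p I. F (x(i := t)))"
    by (rule sum.cartesian_product)
  also have "\<dots> = (\<Sum>x\<in>Vset p (insert i I). F x)"
    by (rule sum.reindex_bij_witness[where j = "\<lambda>(t, x). x(i := t)" and i = "\<lambda>x. (x i, x(i := 0))"])
      (use assms in \<open>auto simp: Vset_def fun_eq_iff split: if_splits\<close>)
  finally show ?thesis by simp
qed

lemma card_Vset: "finite I \<Longrightarrow> finite (Vset p I) \<and> card (Vset p I) = p ^ card I"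
proof (induction I rule: finite_induct)
  case empty
  then show ?case by (simp add: Vset_empty)
next
  case (insert i I)
  have eq: "Vset p (insert i I) = (\<lambda>(t, x). x(i := t)) ` ({0..<int p} \<times> Vset p I)"
  proof (intro equalityI subsetI)
    fix x assume "x \<in> Vset p (insert i I)"
    then have "(x i, x(i := 0)) \<in> {0..<int p} \<times> Vset p I" "x = (x(i := 0))(i := x i)"
      by (auto simp: Vset_def)
    then show "x \<in> (\<lambda>(t, x). x(i := t)) ` ({0..<int p} \<times> Vset p I)"
      by (metis (no_types, lifting) case_prod_conv image_iff)
  qed (use insert.hyps in \<open>auto simp: Vset_def\<close>)
  have fin: "finite (Vset p (insert i I))"
    using insert eq by simp
  have "card (Vset p (insert i I)) = (\<Sum>x\<in>Vset p (insert i I). 1)" by simp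
  also have "\<dots> = p ^ card (insert i I)"
    using insert by (subst sum_Vset_insert) auto
  finally show ?case using fin by simp
qed

text \<open>The standard additive character of F_p, taken on all integers so that phases need no
  reduction.\<close>

definition ep :: "nat \<Rightarrow> int \<Rightarrow> complex" where
  "ep p t = cis (2 * pi * of_int t / of_nat p)"

lemma norm_ep [simp]: "norm (ep p t) = 1"
  by (simp add: ep_def)

lemma ep_add: "ep p (s + t) = ep p s * ep p t"
  by (simp add: ep_def cis_mult add_divide_distrib distrib_left)

lemma ep_0 [simp]: "ep p 0 = 1"
  by (simp add: ep_def)

lemma ep_cnj: "cnj (ep p t) = ep p (- t)"
  by (simp add: ep_def cis_cnj)

lemma ep_eq_1_iff:
  assumes "p > 0"
  shows "ep p t = 1 \<longleftrightarrow> int p dvd t"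
proof
  assume "ep p t = 1"
  then have "cos (2 * pi * of_int t / of_nat p) = 1"
    by (simp add: ep_def complex_eq_iff)
  then obtain k :: int where "2 * pi * of_int t / of_nat p = of_int k * 2 * pi"
    using cos_one_2pi_int by blast
  then have "real_of_int t = of_int k * of_nat p"
    using assms by (simp add: field_simps)
  then have "t = k * int p"
    by (metis of_int_eq_iff of_int_mult of_int_of_nat_eq)
  then show "int p dvd t" by simp
next
  assume "int p dvd t"
  then obtain k where "t = int p * k" by auto
  then have "2 * pi * of_int t / of_nat p = 2 * pi * of_int k"
    using assms by simp
  then show "ep p t = 1"
    by (simp only: ep_def cis_multiple_2pi Ints_of_int)
qed

lemma ep_cong:
  assumes "p > 0" "int p dvd s - t"
  shows "ep p s = ep p t"
  using ep_add[of p "s - t" t] ep_eq_1_iff[OF assms(1), of "s - t"] assms(2) by simp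

lemma ep_sum_line:
  assumes "p > 0"
  shows "(\<Sum>t\<in>{0..<int p}. ep p (t * c)) = of_nat p * of_bool (int p dvd c)"
proof (cases "int p dvd c")
  case True
  then have "ep p (t * c) = 1" for t
    using ep_eq_1_iff[OF assms] by simp
  then show ?thesis using True by simp
next
  case False
  then have ne: "ep p c \<noteq> 1" using ep_eq_1_iff[OF assms] by simp
  have pow: "ep p (int k * c) = ep p c ^ k" for k
    by (induction k) (simp_all add: distrib_right ep_add)
  have "(\<Sum>t\<in>{0..<int p}. ep p (t * c)) = (\<Sum>k\<in>{..<p}. ep p (int k * c))"
    by (rule sum.reindex_bij_witness[of _ int nat]) auto
  also have "\<dots> = (ep p c ^ p - 1) / (ep p c - 1)"
    by (simp add: pow geometric_sum[OF ne])
  also have "ep p c ^ p = 1"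
    using ep_eq_1_iff[OF assms, of "int p * c"] by (simp flip: pow)
  finally show ?thesis using False by simp
qed

text \<open>Orthogonality of characters: the sum factors over the coordinates into geometric sums.
  The index set is arbitrary because the lemma serves twice: with \<open>{..<n}\<close> it evaluates
  linear phases on G, and with a set of labels of conditions it detects that all of them
  hold.\<close>

lemma ep_sum_Vset:
  assumes "p > 0" "finite I"
  shows "(\<Sum>x\<in>Vset p I. ep p (\<Sum>i\<in>I. x i * c i)) = of_nat (p ^ card I) * of_bool (\<forall>i\<in>I. int p dvd c i)"
  using assms(2)
proof (induction I rule: finite_induct)
  case empty
  then show ?case by (simp add: Vset_empty)
next
  case (insert i I)
  have "(\<Sum>x\<in>Vset p (insert i I). ep p (\<Sum>j\<in>insert i I. x j * c j))
      = (\<Sum>t\<in>{0..<int p}. \<Sum>x\<in>Vset p I. ep p (t * c i) * ep p (\<Sum>j\<in>I. x j * c j))"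
    unfolding sum_Vset_insert[OF insert.hyps(2)]
  proof (intro sum.cong refl)
    fix t x
    have "(\<Sum>j\<in>I. (x(i := t)) j * c j) = (\<Sum>j\<in>I. x j * c j)"
      using insert.hyps by (intro sum.cong) auto
    then show "ep p (\<Sum>j\<in>insert i I. (x(i := t)) j * c j) = ep p (t * c i) * ep p (\<Sum>j\<in>I. x j * c j)"
      using insert.hyps by (simp add: ep_add)
  qed
  also have "\<dots> = (\<Sum>t\<in>{0..<int p}. ep p (t * c i)) * (\<Sum>x\<in>Vset p I. ep p (\<Sum>j\<in>I. x j * c j))"
    by (simp add: sum_product)
  finally show ?case
    using insert by (simp add: ep_sum_line[OF assms(1)] of_bool_conj mult_ac)
qed

text \<open>The representative in \<open>Vn p n\<close> of an integer vector. Points are added and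
  subtracted as plain integer functions and reduced once at the end, so that identities between
  forms are ring identities over the integers.\<close>

definition red :: "nat \<Rightarrow> nat \<Rightarrow> (nat \<Rightarrow> int) \<Rightarrow> (nat \<Rightarrow> int)" where
  "red p n w = (\<lambda>i. if i < n then w i mod int p else 0)"

lemma red_in: "p > 0 \<Longrightarrow> red p n w \<in> Vn p n"
  by (auto simp: red_def Vn_def)

lemma red_Vn: "x \<in> Vn p n \<Longrightarrow> red p n x = x"
  by (auto simp: red_def Vn_def fun_eq_iff)

lemma red_red_add: "red p n (red p n x + y) = red p n (x + y)"
  by (auto simp: red_def fun_eq_iff mod_simps)

lemma red_red_diff: "red p n (red p n x - y) = red p n (x - y)"
  by (auto simp: red_def fun_eq_iff mod_simps)

lemma sum_Vn_shift:
  assumes "p > 0"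
  shows "(\<Sum>x\<in>Vn p n. F (red p n (x + w))) = (\<Sum>x\<in>Vn p n. F x)"
  by (rule sum.reindex_bij_witness[where i = "\<lambda>x. red p n (x - w)" and j = "\<lambda>x. red p n (x + w)"])
    (use assms in \<open>auto simp: red_in red_red_add red_red_diff red_Vn\<close>)

section \<open>Integer-valued dot products and bilinear forms, and their behaviour under
  reduction\<close>

definition dot :: "nat \<Rightarrow> (nat \<Rightarrow> int) \<Rightarrow> (nat \<Rightarrow> int) \<Rightarrow> int" where
  "dot n x y = (\<Sum>i<n. x i * y i)"

definition mv :: "nat \<Rightarrow> (nat \<Rightarrow> nat \<Rightarrow> int) \<Rightarrow> (nat \<Rightarrow> int) \<Rightarrow> (nat \<Rightarrow> int)" where
  "mv n M y = (\<lambda>i. \<Sum>j<n. M i j * y j)"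

definition bil :: "nat \<Rightarrow> (nat \<Rightarrow> nat \<Rightarrow> int) \<Rightarrow> (nat \<Rightarrow> int) \<Rightarrow> (nat \<Rightarrow> int) \<Rightarrow> int" where
  "bil n M x y = dot n x (mv n M y)"

lemma dotp_eq: "dotp p n x y = dot n x y mod int p"
  by (simp add: dotp_def dot_def)

lemma bilin_eq: "bilin p n M x y = bil n M x y mod int p"
  by (simp add: bilin_def bil_def dot_def mv_def sum_distrib_left mult_ac)

lemma dot_simps:
  "dot n (x + y) z = dot n x z + dot n y z"
  "dot n (x - y) z = dot n x z - dot n y z"
  "dot n z (x + y) = dot n z x + dot n z y"
  "dot n z (x - y) = dot n z x - dot n z y"
  by (simp_all add: dot_def distrib_left distrib_right left_diff_distrib right_diff_distrib
      sum.distrib sum_subtractf)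

lemma mv_simps:
  "mv n M (x + y) = mv n M x + mv n M y"
  "mv n M (x - y) = mv n M x - mv n M y"
  by (simp_all add: mv_def fun_eq_iff distrib_left right_diff_distrib sum.distrib sum_subtractf)

lemma bil_simps:
  "bil n M (x + y) z = bil n M x z + bil n M y z"
  "bil n M (x - y) z = bil n M x z - bil n M y z"
  "bil n M z (x + y) = bil n M z x + bil n M z y"
  "bil n M z (x - y) = bil n M z x - bil n M z y"
  by (simp_all add: bil_def dot_simps mv_simps)

lemma bil_commute:
  assumes "symm_mat n M"
  shows "bil n M x y = bil n M y x"
proof -
  have "bil n M x y = (\<Sum>i<n. \<Sum>j<n. x i * (M i j * y j))"
    by (simp add: bil_def dot_def mv_def sum_distrib_left)
  also have "\<dots> = (\<Sum>j<n. \<Sum>i<n. x i * (M i j * y j))" by (rule sum.swap)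
  also have "\<dots> = bil n M y x"
    using assms by (simp add: bil_def dot_def mv_def sum_distrib_left symm_mat_def mult_ac)
  finally show ?thesis .
qed

lemma dvd_diff_cong: "(k::int) dvd a - b \<Longrightarrow> k dvd a - c \<longleftrightarrow> k dvd b - c"
  by (metis add_diff_cancel_left' diff_add_cancel diff_diff_eq2 dvd_add_right_iff dvd_diff_commute)

lemma dvd_red_diff: "i < n \<Longrightarrow> int p dvd red p n x i - x i"
  by (simp add: red_def mod_eq_dvd_iff[symmetric])

lemma dvd_dot_red: "int p dvd dot n (red p n x) z - dot n x z"
  by (auto simp: dot_def sum_subtractf[symmetric] left_diff_distrib[symmetric]
      intro!: dvd_sum dvd_mult2 dvd_red_diff)

lemma dvd_mv_red: "int p dvd mv n M (red p n x) i - mv n M x i"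
  by (auto simp: mv_def sum_subtractf[symmetric] right_diff_distrib[symmetric]
      intro!: dvd_sum dvd_mult dvd_red_diff)

lemma dvd_bil_red_left: "int p dvd bil n M (red p n x) z - bil n M x z"
  by (simp add: bil_def dvd_dot_red)

lemma dvd_bil_red_right: "int p dvd bil n M z (red p n x) - bil n M z x"
  by (auto simp: bil_def dot_def sum_subtractf[symmetric] right_diff_distrib[symmetric]
      intro!: dvd_sum dvd_mult dvd_mv_red)

lemma dvd_bil_red: "int p dvd bil n M (red p n x) (red p n y) - bil n M x y"
  using dvd_add[OF dvd_bil_red_left[of p n M x "red p n y"] dvd_bil_red_right[of p n M x y]] by simp

section \<open>Exponential sums of quadratic phases\<close>

lemma ep_diff: "ep p (s - t) = ep p s * ep p (- t)"
  using ep_add[of p s "- t"] by simp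

lemma dot_scale: "dot n x (\<lambda>i. c * y i) = c * dot n x y"
  by (simp add: dot_def sum_distrib_left mult_ac)

lemma finite_Vn [simp]: "finite (Vn p n)"
  by (simp add: Vn_eq_Vset card_Vset)

lemma card_Vn: "card (Vn p n) = p ^ n"
  by (simp add: Vn_eq_Vset card_Vset)

lemma ep_sum_dot:
  assumes "p > 0"
  shows "(\<Sum>x\<in>Vn p n. ep p (dot n x c)) = of_nat (p ^ n) * of_bool (\<forall>i<n. int p dvd c i)"
  using ep_sum_Vset[OF assms, of "{..<n}" c] by (simp add: Vn_eq_Vset dot_def Ball_def)

text \<open>Translating the solution set by the vectors supported on \<open>S\<close> produces disjoint copies.\<close>

lemma card_affine_solutions:
  assumes p: "p > 0" and S: "S \<subseteq> {..<n}" "cols_indep p n M S"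
  shows "card {y \<in> Vn p n. \<forall>i<n. int p dvd mv n M y i + c i} * p ^ card S \<le> p ^ n"
proof -
  let ?Y = "{y \<in> Vn p n. \<forall>i<n. int p dvd mv n M y i + c i}"
  let ?U = "Vset p S"
  let ?g = "\<lambda>(y, u). red p n (y + u)"
  have finS: "finite S" using S finite_subset by blast
  have inj: "inj_on ?g (?Y \<times> ?U)"
  proof (rule inj_onI, clarify)
    fix y u y' u'
    assume y: "y \<in> Vn p n" "\<forall>i<n. int p dvd mv n M y i + c i"
      and y': "y' \<in> Vn p n" "\<forall>i<n. int p dvd mv n M y' i + c i"
      and u: "u \<in> ?U" "u' \<in> ?U" and eq: "red p n (y + u) = red p n (y' + u')"
    have d: "int p dvd (y' j - y j) - (u j - u' j)" if "j < n" for j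
    proof -
      have "(y j + u j) mod int p = (y' j + u' j) mod int p"
        using fun_cong[OF eq, of j] that by (simp add: red_def)
      then have "int p dvd (y j + u j) - (y' j + u' j)" by (simp add: mod_eq_dvd_iff)
      then have "int p dvd - ((y j + u j) - (y' j + u' j))" by (simp only: dvd_minus_iff)
      then show ?thesis by (simp add: algebra_simps)
    qed
    \<comment> \<open>Both \<open>y\<close> and \<open>y'\<close> solve the system, so
      \<open>M\<close> kills \<open>y' - y\<close> and with it \<open>u - u'\<close> modulo
      \<open>p\<close>. This vector is supported on \<open>S\<close>, where the columns are
      independent.\<close>
    have "\<forall>i<n. (\<Sum>j\<in>S. M i j * (u j - u' j)) mod int p = 0"
    proof (intro allI impI)
      fix i assume "i < n"
      have "int p dvd (mv n M y' i + c i) - (mv n M y i + c i)"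
        using y y' \<open>i < n\<close> by (intro dvd_diff) auto
      then have 1: "int p dvd (\<Sum>j<n. M i j * (y' j - y j))"
        by (simp add: mv_def sum_subtractf right_diff_distrib)
      have "int p dvd (\<Sum>j<n. M i j * ((y' j - y j) - (u j - u' j)))"
        using d by (intro dvd_sum dvd_mult) auto
      then have "int p dvd (\<Sum>j<n. M i j * (y' j - y j)) - (\<Sum>j<n. M i j * (u j - u' j))"
        by (simp add: sum_subtractf right_diff_distrib)
      with 1 have "int p dvd (\<Sum>j<n. M i j * (u j - u' j))"
        by (metis add_diff_cancel_left' diff_add_cancel dvd_diff)
      also have "(\<Sum>j<n. M i j * (u j - u' j)) = (\<Sum>j\<in>S. M i j * (u j - u' j))"
        using S u by (intro sum.mono_neutral_right) (auto simp: Vset_def)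
      finally show "(\<Sum>j\<in>S. M i j * (u j - u' j)) mod int p = 0" by simp
    qed
    then have "\<forall>j\<in>S. (u j - u' j) mod int p = 0"
      using S(2)[unfolded cols_indep_def, rule_format, of "\<lambda>j. u j - u' j"] by blast
    then have "\<forall>j\<in>S. u j mod int p = u' j mod int p"
      by (simp add: mod_eq_dvd_iff mod_eq_0_iff_dvd)
    then have uu: "u = u'"
      using u by (auto simp: Vset_def fun_eq_iff)
    have "red p n y = red p n (red p n (y + u) - u)" by (simp add: red_red_diff)
    also have "\<dots> = red p n (red p n (y' + u') - u')" using eq uu by simp
    also have "\<dots> = red p n y'" by (simp add: red_red_diff)
    finally show "y = y' \<and> u = u'"
      using uu y y' by (simp add: red_Vn)
  qed
  have "card ?Y * p ^ card S = card (?Y \<times> ?U)"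
    using finS by (simp add: card_cartesian_product card_Vset)
  also have "\<dots> = card (?g ` (?Y \<times> ?U))"
    by (rule card_image[OF inj, symmetric])
  also have "\<dots> \<le> card (Vn p n)"
    by (rule card_mono) (auto simp: red_in p)
  finally show ?thesis by (simp add: card_Vn)
qed

text \<open>Weyl differencing: in the squared modulus substitute \<open>y = h + x\<close>. The phase
  difference is then linear in \<open>x\<close>, so the sum over \<open>x\<close> is
  \<open>p ^ n\<close> up to a unimodular factor if \<open>M h\<close> vanishes modulo
  \<open>p\<close>, and 0 otherwise; \<open>card_affine_solutions\<close> bounds the number of such
  \<open>h\<close>.\<close>

lemma quadratic_exponential_sum_bound:
  assumes p: "p > 0" "odd p" and M: "symm_mat n M" and S: "S \<subseteq> {..<n}" "cols_indep p n M S"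
  shows "norm (\<Sum>x\<in>Vn p n. ep p (bil n M x x + dot n x c)) ^ 2 * real p ^ card S \<le> (real p ^ n) ^ 2"
proof -
  let ?V = "Vn p n"
  define \<phi> where "\<phi> x = bil n M x x + dot n x c" for x
  let ?K = "{h \<in> ?V. \<forall>i<n. int p dvd mv n M h i}"
  have kern: "(\<Sum>x\<in>?V. ep p (\<phi> (red p n (h + x)) - \<phi> x))
      = ep p (\<phi> h) * of_nat (p ^ n) * of_bool (h \<in> ?K)" if h: "h \<in> ?V" for h
  proof -
    have "ep p (\<phi> (red p n (h + x)) - \<phi> x) = ep p (\<phi> h) * ep p (dot n x (\<lambda>i. 2 * mv n M h i))" for x
    proof -
      have "int p dvd \<phi> (red p n (h + x)) - \<phi> (h + x)"
        using dvd_add[OF dvd_bil_red[of p n M "h + x" "h + x"] dvd_dot_red[of p n "h + x" c]]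
        by (simp add: \<phi>_def algebra_simps)
      then have "ep p (\<phi> (red p n (h + x)) - \<phi> x) = ep p (\<phi> (h + x) - \<phi> x)"
        by (intro ep_cong p) simp
      moreover have "\<phi> (h + x) - \<phi> x = \<phi> h + dot n x (\<lambda>i. 2 * mv n M h i)"
        using bil_commute[OF M, of h x] by (simp add: \<phi>_def bil_simps dot_simps dot_scale bil_def[of n M x h, symmetric])
      ultimately show ?thesis by (simp only: ep_add)
    qed
    then have "(\<Sum>x\<in>?V. ep p (\<phi> (red p n (h + x)) - \<phi> x))
        = ep p (\<phi> h) * (\<Sum>x\<in>?V. ep p (dot n x (\<lambda>i. 2 * mv n M h i)))"
      by (simp add: sum_distrib_left)
    \<comment> \<open>The symmetric matrix contributes \<open>2 M h\<close> to the linear phase; as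
      \<open>p\<close> is odd, this vanishes exactly when \<open>M h\<close> does.\<close>
    moreover have "int p dvd 2 * a \<longleftrightarrow> int p dvd a" for a
    proof -
      have "coprime (int p) 2" using p(2) by simp
      then show ?thesis using coprime_dvd_mult_right_iff[of "int p" 2 a] by simp
    qed
    ultimately show ?thesis
      using h by (simp add: ep_sum_dot[OF p(1)])
  qed
  have "of_real (norm (\<Sum>x\<in>?V. ep p (\<phi> x)) ^ 2)
      = (\<Sum>y\<in>?V. ep p (\<phi> y)) * cnj (\<Sum>x\<in>?V. ep p (\<phi> x))"
    by (rule complex_norm_square)
  also have "\<dots> = (\<Sum>x\<in>?V. \<Sum>y\<in>?V. ep p (\<phi> y - \<phi> x))"
    by (subst sum.swap) (simp add: sum_product ep_cnj ep_diff)
  also have "\<dots> = (\<Sum>x\<in>?V. \<Sum>h\<in>?V. ep p (\<phi> (red p n (h + x)) - \<phi> x))"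
    by (rule sum.cong[OF refl], rule sum_Vn_shift[OF p(1), symmetric])
  also have "\<dots> = (\<Sum>h\<in>?V. \<Sum>x\<in>?V. ep p (\<phi> (red p n (h + x)) - \<phi> x))"
    by (rule sum.swap)
  also have "\<dots> = (\<Sum>h\<in>?V. ep p (\<phi> h) * of_nat (p ^ n) * of_bool (h \<in> ?K))"
    by (intro sum.cong refl kern)
  finally have "norm (\<Sum>x\<in>?V. ep p (\<phi> x)) ^ 2
      = norm (\<Sum>h\<in>?V. ep p (\<phi> h) * of_nat (p ^ n) * of_bool (h \<in> ?K))"
    by (metis norm_of_real abs_of_nonneg zero_le_power2)
  also have "\<dots> \<le> (\<Sum>h\<in>?V. real (p ^ n) * of_bool (h \<in> ?K))"
    by (rule sum_norm_le) (auto simp: norm_mult norm_power)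
  also have "\<dots> = real (p ^ n) * card ?K"
    by (simp add: sum_distrib_left[symmetric] sum.If_cases of_bool_def Int_def)
  finally have "norm (\<Sum>x\<in>?V. ep p (\<phi> x)) ^ 2 * real p ^ card S \<le> real (p ^ n) * real (card ?K) * real p ^ card S"
    by (intro mult_right_mono) auto
  also have "\<dots> = real (p ^ n) * real (card ?K * p ^ card S)" by simp
  also have "\<dots> \<le> real (p ^ n) * real (p ^ n)"
    using card_affine_solutions[OF p(1) S, of "\<lambda>_. 0"] by (intro mult_left_mono) (auto simp flip: of_nat_mult of_nat_power)
  finally show ?thesis by (simp add: \<phi>_def power2_eq_square)
qed

section \<open>Rank of the combinations of the matrices of a factor\<close>

lemma cols_indep_of_rank: "\<exists>S. S \<subseteq> {..<n} \<and> cols_indep p n M S \<and> card S = mat_rank p n M"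
proof -
  let ?R = "{card S | S. S \<subseteq> {..<n} \<and> cols_indep p n M S}"
  have "?R \<subseteq> {..n}"
    using card_mono[of "{..<n}"] by auto
  then have "finite ?R" using finite_subset by blast
  moreover have "card {} \<in> ?R"
    by (rule CollectI, rule exI[of _ "{}"]) (simp add: cols_indep_def)
  ultimately have "Max ?R \<in> ?R" using Max_in by blast
  then show ?thesis unfolding mat_rank_def by auto
qed

definition comb :: "(nat \<Rightarrow> nat \<Rightarrow> int) list \<Rightarrow> (nat \<Rightarrow> int) \<Rightarrow> nat \<Rightarrow> nat \<Rightarrow> int" where
  "comb Ms \<mu> = (\<lambda>i j. \<Sum>k<length Ms. \<mu> k * (Ms!k) i j)"

lemma qf_rank_le:
  assumes "\<And>k. k < length Ms \<Longrightarrow> 0 \<le> \<mu> k \<and> \<mu> k < int p" "k0 < length Ms" "\<mu> k0 \<noteq> 0"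
  shows "qf_rank p n Ms \<le> mat_rank p n (comb Ms \<mu>)"
proof -
  let ?R = "{mat_rank p n (\<lambda>i j. \<Sum>k<length Ms. lam k * (Ms!k) i j) | lam.
                  (\<forall>k<length Ms. 0 \<le> lam k \<and> lam k < int p) \<and> (\<exists>k<length Ms. lam k \<noteq> 0)}"
  have "mat_rank p n M \<le> n" for M
  proof -
    obtain S where "S \<subseteq> {..<n}" "card S = mat_rank p n M"
      using cols_indep_of_rank[of n p M] by blast
    then show ?thesis using card_mono[of "{..<n}" S] by simp
  qed
  then have "?R \<subseteq> {..n}" by auto
  then have "finite ?R" using finite_subset by blast
  moreover have "mat_rank p n (comb Ms \<mu>) \<in> ?R"
    unfolding comb_def using assms by blast
  ultimately show ?thesis
    using assms(2) by (auto simp: qf_rank_def)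
qed

lemma bil_comb: "bil n (comb Ms \<mu>) x y = (\<Sum>k<length Ms. \<mu> k * bil n (Ms!k) x y)"
proof -
  have "bil n (comb Ms \<mu>) x y = (\<Sum>i<n. \<Sum>j<n. \<Sum>k<length Ms. \<mu> k * (x i * ((Ms!k) i j * y j)))"
    by (simp add: bil_def dot_def mv_def comb_def sum_distrib_left sum_distrib_right mult_ac)
  also have "\<dots> = (\<Sum>k<length Ms. \<Sum>i<n. \<Sum>j<n. \<mu> k * (x i * ((Ms!k) i j * y j)))"
    by (simp add: sum.swap[of _ "{..<length Ms}"])
  finally show ?thesis
    by (simp add: bil_def dot_def mv_def sum_distrib_left)
qed

lemma symm_comb: "(\<And>M. M \<in> set Ms \<Longrightarrow> symm_mat n M) \<Longrightarrow> symm_mat n (comb Ms \<mu>)"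
  by (auto simp: symm_mat_def comb_def intro!: sum.cong)

section \<open>Counting extensions of a configuration\<close>

text \<open>Sums over configurations of 0, 1, 2, 4 and 5 vectors are needed; summing over lists of
  variable length allows a single bound for all of them.\<close>

primrec isum :: "'a set \<Rightarrow> nat \<Rightarrow> ('a list \<Rightarrow> real) \<Rightarrow> real" where
  "isum V 0 F = F []"
| "isum V (Suc m) F = (\<Sum>w\<in>V. isum V m (\<lambda>ws. F (w # ws)))"

lemma isum_mono:
  assumes "\<And>ws. length ws = m \<Longrightarrow> F ws \<le> G ws"
  shows "isum V m F \<le> isum V m G"
  using assms by (induction m arbitrary: F G) (auto intro!: sum_mono)

lemma isum_const: "isum V m (\<lambda>_. c) = real (card V) ^ m * c"
  by (induction m) auto

lemma isum_sum: "isum V m (\<lambda>ws. \<Sum>a\<in>A. F a ws) = (\<Sum>a\<in>A. isum V m (F a))"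
proof (induction m arbitrary: F)
  case (Suc m)
  then show ?case by (simp add: sum.swap[of _ V A])
qed simp

lemma isum_divide: "isum V m (\<lambda>ws. F ws / c) = isum V m F / c"
  by (induction m arbitrary: F) (simp_all add: sum_divide_distrib)

text \<open>It is enough to gain in one variable, uniformly in the others; these are then summed
  trivially.\<close>

lemma isum_slot:
  assumes "i < m"
    and "\<And>ws us. length ws = i \<Longrightarrow> length us = m - Suc i \<Longrightarrow> (\<Sum>w\<in>V. F (ws @ w # us)) \<le> B"
  shows "isum V m F \<le> real (card V) ^ (m - 1) * B"
  using assms
proof (induction m arbitrary: i F)
  case (Suc m)
  show ?case
  proof (cases i)
    case 0
    have "isum V (Suc m) F = isum V m (\<lambda>us. \<Sum>w\<in>V. F (w # us))"
      by (simp add: isum_sum)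
    also have "\<dots> \<le> isum V m (\<lambda>_. B)"
      using Suc.prems(2)[of "[]"] 0 by (intro isum_mono) auto
    finally show ?thesis by (simp add: isum_const)
  next
    case (Suc i')
    have "isum V m (\<lambda>ws. F (w # ws)) \<le> real (card V) ^ (m - 1) * B" for w
    proof (rule Suc.IH)
      show "i' < m" using Suc.prems(1) Suc by simp
      fix ws us :: "'a list"
      assume "length ws = i'" "length us = m - Suc i'"
      then show "(\<Sum>v\<in>V. F (w # ws @ v # us)) \<le> B"
        using Suc.prems(2)[of "w # ws" us] Suc by simp
    qed
    then have "isum V (Suc m) F \<le> (\<Sum>w\<in>V. real (card V) ^ (m - 1) * B)"
      unfolding isum.simps by (intro sum_mono)
    also have "\<dots> = real (card V) ^ m * B"
      using Suc.prems(1) Suc by (cases m) auto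
    finally show ?thesis by simp
  qed
qed simp

section \<open>Fourier analysis of the conditions on one new vertex\<close>

locale quadratic_factor =
  fixes p n :: nat and rs :: "(nat \<Rightarrow> int) list" and Ms :: "(nat \<Rightarrow> nat \<Rightarrow> int) list"
  assumes prime_p: "prime p" and odd_p: "odd p"
    and lin: "is_linear_factor p n rs" and quad: "is_pquad_factor p n Ms"
begin

abbreviation "V \<equiv> Vn p n"
abbreviation "N \<equiv> real p ^ n"
abbreviation "l \<equiv> length rs"
abbreviation "q \<equiv> length Ms"

text \<open>For the trivial factor all counts are exact. The value 0 there makes the error vanish;
  otherwise absolute constants are absorbed into powers of \<open>p ^ (l + q) \<ge> 3\<close>.\<close>

definition \<delta> :: real where
  "\<delta> = (if l + q = 0 then 0 else real p powr (- (real (qf_rank p n Ms) / 2)))"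

lemma p_pos: "p > 0" using prime_p prime_gt_0_nat by blast
lemma p_ge_3: "p \<ge> 3"
  using prime_p odd_p prime_ge_2_nat[of p] by (cases "p = 2") auto
lemma N_pos: "N > 0" using p_pos by simp
lemma card_V: "real (card V) = N" by (simp add: card_Vn)
lemma \<delta>_nonneg: "\<delta> \<ge> 0" by (simp add: \<delta>_def)
lemma symm_Ms: "k < q \<Longrightarrow> symm_mat n (Ms!k)"
  using quad by (auto simp: is_pquad_factor_def)

text \<open>A Gauss sum is bounded through its square, so the bound \<open>\<delta> ^ 2\<close> is
  what yields a saving of \<delta> there. A linear system saves \<open>\<delta> ^ 2\<close>
  directly; this is weakened to \<delta> so that all frequencies share one bound.\<close>

lemma rank_comb:
  assumes "\<And>k. k < q \<Longrightarrow> 0 \<le> \<mu> k \<and> \<mu> k < int p" "k0 < q" "\<mu> k0 \<noteq> 0"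
  obtains S where "S \<subseteq> {..<n}" "cols_indep p n (comb Ms \<mu>) S" "1 / real p ^ card S \<le> \<delta> ^ 2"
    "1 / real p ^ card S \<le> \<delta>"
proof -
  obtain S where S: "S \<subseteq> {..<n}" "cols_indep p n (comb Ms \<mu>) S" "card S = mat_rank p n (comb Ms \<mu>)"
    using cols_indep_of_rank by blast
  have le: "qf_rank p n Ms \<le> card S"
    using qf_rank_le[of Ms \<mu> p k0 n] assms S(3) by simp
  \<comment> \<open>\<open>k0 < q\<close> rules out the default value 0 of \<delta>.\<close>
  have d: "\<delta> = real p powr (- (real (qf_rank p n Ms) / 2))"
    using assms(2) by (auto simp: \<delta>_def)
  have p1: "1 \<le> real p" using p_pos by simp
  have "1 / real p ^ card S = real p powr (- real (card S))"
    using p_pos by (simp add: powr_minus powr_realpow divide_inverse)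
  also have "\<dots> \<le> real p powr (- real (qf_rank p n Ms))"
    using le p1 by (intro powr_mono) auto
  also have "\<dots> = \<delta> ^ 2"
    by (simp add: d power2_eq_square powr_add[symmetric])
  finally have 1: "1 / real p ^ card S \<le> \<delta> ^ 2" .
  have "\<delta> \<le> real p powr 0"
    unfolding d using p1 by (intro powr_mono) auto
  then have "\<delta> ^ 2 \<le> \<delta>"
    using \<delta>_nonneg p_pos by (auto simp: power2_eq_square intro: mult_left_le)
  with 1 have "1 / real p ^ card S \<le> \<delta>" by linarith
  with 1 S show ?thesis using that by blast
qed

text \<open>Everything demanded of a new vertex \<open>v\<close>, given the vectors
  \<open>ws\<close> chosen before it, in one family. A frequency is then a function on pairs, and
  each of its rows \<open>j \<ge> 1\<close> is a coefficient vector for \<open>comb\<close>.\<close>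

definition constraint :: "(nat \<Rightarrow> int) list \<Rightarrow> (nat \<Rightarrow> int) \<Rightarrow> nat \<times> nat \<Rightarrow> int" where
  "constraint ws v = (\<lambda>(j, k). if j = 0 then dot n v (rs!k) else if j = 1 then bil n (Ms!k) v v
     else bil n (Ms!k) v (ws!(j - 2)))"

definition Ifull :: "nat \<Rightarrow> (nat \<times> nat) set" where
  "Ifull m = {0} \<times> {..<l} \<union> ({1} \<times> {..<q} \<union> (\<lambda>j. j + 2) ` {..<m} \<times> {..<q})"

text \<open>Bounds the deviation of a count for all target values at once, so that the targets may depend on
  \<open>ws\<close> when the bound is averaged over \<open>ws\<close>.\<close>

definition dev :: "(nat \<times> nat) set \<Rightarrow> (nat \<Rightarrow> int) list \<Rightarrow> real" where
  "dev I ws = (\<Sum>\<xi>\<in>Vset p I - {\<lambda>_. 0}. norm (\<Sum>v\<in>V. ep p (\<Sum>i\<in>I. \<xi> i * constraint ws v i))) / real p ^ card I"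

text \<open>Fourier expansion of the indicator: the zero frequency is the main term, and the targets
  \<open>T\<close> enter only through the unimodular factors \<open>?t\<close>, which disappear when
  norms are taken.\<close>

lemma count_deviation:
  assumes I: "finite I"
  shows "\<bar>(\<Sum>v\<in>V. of_bool (\<forall>i\<in>I. int p dvd constraint ws v i - T i)) - N / real p ^ card I\<bar> \<le> dev I ws"
proof -
  let ?c = "(\<Sum>v\<in>V. of_bool (\<forall>i\<in>I. int p dvd constraint ws v i - T i)) :: real"
  let ?L = "Vset p I"
  let ?\<phi> = "\<lambda>\<xi>. \<Sum>v\<in>V. ep p (\<Sum>i\<in>I. \<xi> i * constraint ws v i)"
  let ?t = "\<lambda>\<xi>. ep p (- (\<Sum>i\<in>I. \<xi> i * T i))"
  have finL: "finite ?L" using card_Vset[OF I] by blast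
  have z: "(\<lambda>_. 0) \<in> ?L" using p_pos by (simp add: Vset_def)
  have "of_real (?c * real p ^ card I)
      = (\<Sum>v\<in>V. of_nat (p ^ card I) * of_bool (\<forall>i\<in>I. int p dvd constraint ws v i - T i) :: complex)"
    by (simp add: sum_distrib_left mult.commute)
  also have "\<dots> = (\<Sum>v\<in>V. \<Sum>\<xi>\<in>?L. ep p (\<Sum>i\<in>I. \<xi> i * (constraint ws v i - T i)))"
    by (simp add: ep_sum_Vset[OF p_pos I])
  also have "\<dots> = (\<Sum>\<xi>\<in>?L. \<Sum>v\<in>V. ep p (\<Sum>i\<in>I. \<xi> i * (constraint ws v i - T i)))"
    by (rule sum.swap)
  also have "\<dots> = (\<Sum>\<xi>\<in>?L. ?t \<xi> * ?\<phi> \<xi>)"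
    by (simp add: right_diff_distrib sum_subtractf ep_diff sum_distrib_left mult.commute)
  also have "\<dots> = of_nat (card V) + (\<Sum>\<xi>\<in>?L - {\<lambda>_. 0}. ?t \<xi> * ?\<phi> \<xi>)"
    by (subst sum.remove[OF finL z]) simp
  finally have "of_real (?c * real p ^ card I - N) = (\<Sum>\<xi>\<in>?L - {\<lambda>_. 0}. ?t \<xi> * ?\<phi> \<xi>)"
    by (simp add: card_Vn)
  then have "\<bar>?c * real p ^ card I - N\<bar> = norm (\<Sum>\<xi>\<in>?L - {\<lambda>_. 0}. ?t \<xi> * ?\<phi> \<xi>)"
    by (simp only: norm_of_real[where 'a = complex, symmetric])
  also have "\<dots> \<le> (\<Sum>\<xi>\<in>?L - {\<lambda>_. 0}. norm (?\<phi> \<xi>))"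
    by (rule sum_norm_le) (simp add: norm_mult)
  also have "\<dots> = dev I ws * real p ^ card I"
    using p_pos by (simp add: dev_def)
  finally have "\<bar>?c * real p ^ card I - N\<bar> / real p ^ card I \<le> dev I ws"
    using p_pos by (simp add: divide_le_eq)
  also have "\<bar>?c * real p ^ card I - N\<bar> / real p ^ card I = \<bar>?c - N / real p ^ card I\<bar>"
  proof -
    have "?c - N / real p ^ card I = (?c * real p ^ card I - N) / real p ^ card I"
      using p_pos by (simp add: diff_divide_distrib)
    then show ?thesis by (simp only: abs_divide) simp
  qed
  finally show ?thesis .
qed

text \<open>Grouped by rows of \<xi>, the phase is one quadratic form with a single matrix plus a
  linear form, the shape required by \<open>quadratic_exponential_sum_bound\<close>.\<close>

lemma phase_eq:
  assumes I: "I \<subseteq> Ifull m" and lam: "\<xi> \<in> Vset p I"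
  shows "(\<Sum>i\<in>I. \<xi> i * constraint ws v i) = bil n (comb Ms (\<lambda>k. \<xi> (1, k))) v v
    + dot n v (\<lambda>i. (\<Sum>k<l. \<xi> (0, k) * (rs!k) i) + (\<Sum>j<m. mv n (comb Ms (\<lambda>k. \<xi> (j + 2, k))) (ws!j) i))"
proof -
  have "(\<Sum>i\<in>I. \<xi> i * constraint ws v i) = (\<Sum>i\<in>Ifull m. \<xi> i * constraint ws v i)"
    using I lam by (intro sum.mono_neutral_left) (auto simp: Vset_def Ifull_def)
  also have "\<dots> = (\<Sum>i\<in>{0} \<times> {..<l}. \<xi> i * constraint ws v i) + ((\<Sum>i\<in>{1} \<times> {..<q}. \<xi> i * constraint ws v i)
      + (\<Sum>i\<in>(\<lambda>j. j + 2) ` {..<m} \<times> {..<q}. \<xi> i * constraint ws v i))"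
    unfolding Ifull_def by (subst sum.union_disjoint, simp, simp, fastforce)+ simp
  also have "(\<Sum>i\<in>{0} \<times> {..<l}. \<xi> i * constraint ws v i) = (\<Sum>k<l. \<xi> (0, k) * dot n v (rs!k))"
    by (simp add: sum.cartesian_product' constraint_def)
  also have "\<dots> = dot n v (\<lambda>i. \<Sum>k<l. \<xi> (0, k) * (rs!k) i)"
    by (simp add: dot_def sum_distrib_left sum.swap[of _ "{..<n}"] mult_ac)
  also have "(\<Sum>i\<in>{1} \<times> {..<q}. \<xi> i * constraint ws v i) = bil n (comb Ms (\<lambda>k. \<xi> (1, k))) v v"
    by (simp add: sum.cartesian_product' constraint_def bil_comb)
  also have "(\<Sum>i\<in>(\<lambda>j. j + 2) ` {..<m} \<times> {..<q}. \<xi> i * constraint ws v i)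
      = (\<Sum>j<m. bil n (comb Ms (\<lambda>k. \<xi> (j + 2, k))) v (ws!j))"
    by (simp add: sum.cartesian_product' sum.reindex inj_on_def constraint_def bil_comb)
  also have "\<dots> = dot n v (\<lambda>i. \<Sum>j<m. mv n (comb Ms (\<lambda>k. \<xi> (j + 2, k))) (ws!j) i)"
    by (simp add: bil_def dot_def sum_distrib_left sum.swap[of _ "{..<n}"])
  finally show ?thesis by (simp add: dot_def distrib_left sum.distrib)
qed

text \<open>Summing over \<open>ws\<close> is essential: if all entries of \<open>ws\<close> are 0,
  a frequency living on the rows \<open>j \<ge> 2\<close> alone has phase 0. If row 1 is nonzero,
  the Gauss sum bound holds for every \<open>ws\<close>. If it is zero but row \<open>i + 2\<close>
  is not, then with the other entries fixed few choices of entry \<open>i\<close> make the linear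
  phase vanish. If only row 0 is left, independence of the vectors in \<open>rs\<close> makes the
  sum 0.\<close>

lemma isum_norm_phase:
  assumes I: "I \<subseteq> Ifull m" and lam: "\<xi> \<in> Vset p I" "\<xi> \<noteq> (\<lambda>_. 0)"
  shows "isum V m (\<lambda>ws. norm (\<Sum>v\<in>V. ep p (\<Sum>i\<in>I. \<xi> i * constraint ws v i))) \<le> \<delta> * N ^ (m + 1)"
proof -
  let ?M = "\<lambda>j. comb Ms (\<lambda>k. \<xi> (j, k))"
  let ?R = "\<lambda>i. \<Sum>k<l. \<xi> (0, k) * (rs!k) i"
  have rng: "0 \<le> \<xi> (j, k) \<and> \<xi> (j, k) < int p" for j k
    using lam(1) p_pos by (cases "(j, k) \<in> I") (auto simp: Vset_def)
  have ph: "(\<Sum>i\<in>I. \<xi> i * constraint ws v i) = bil n (?M 1) v v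
      + dot n v (\<lambda>i. ?R i + (\<Sum>j<m. mv n (?M (j + 2)) (ws!j) i))" for ws v
    by (rule phase_eq[OF I lam(1)])
  obtain j0 k0 where jk: "(j0, k0) \<in> Ifull m" "\<xi> (j0, k0) \<noteq> 0"
    using lam I by (force simp: Vset_def fun_eq_iff)
  consider (diag) k where "k < q" "\<xi> (1, k) \<noteq> 0"
    | (cross) i k where "\<forall>k<q. \<xi> (1, k) = 0" "i < m" "k < q" "\<xi> (i + 2, k) \<noteq> 0"
    | (lin) k where "\<forall>k<q. \<xi> (1, k) = 0" "\<forall>j<m. \<forall>k<q. \<xi> (j + 2, k) = 0" "k < l" "\<xi> (0, k) \<noteq> 0"
    using jk unfolding Ifull_def by fastforce
  then show ?thesis
  proof cases
    case diag
    obtain S where S: "S \<subseteq> {..<n}" "cols_indep p n (?M 1) S" "1 / real p ^ card S \<le> \<delta> ^ 2"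
      by (rule rank_comb[of "\<lambda>k. \<xi> (1, k)" k]) (use rng diag in auto)
    have "norm (\<Sum>v\<in>V. ep p (\<Sum>i\<in>I. \<xi> i * constraint ws v i)) \<le> \<delta> * N" for ws
    proof (rule power2_le_imp_le)
      have symm: "symm_mat n (?M 1)"
        using quad by (intro symm_comb) (auto simp: is_pquad_factor_def)
      have "norm (\<Sum>v\<in>V. ep p (\<Sum>i\<in>I. \<xi> i * constraint ws v i)) ^ 2 \<le> N ^ 2 * (1 / real p ^ card S)"
        using quadratic_exponential_sum_bound[OF p_pos odd_p symm S(1,2)] p_pos
        unfolding ph by (simp add: pos_le_divide_eq)
      also have "\<dots> \<le> N ^ 2 * \<delta> ^ 2"
        by (intro mult_left_mono S) simp
      finally show "norm (\<Sum>v\<in>V. ep p (\<Sum>i\<in>I. \<xi> i * constraint ws v i)) ^ 2 \<le> (\<delta> * N) ^ 2"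
        by (simp only: power_mult_distrib mult.commute)
    qed (simp add: \<delta>_nonneg)
    then have "isum V m (\<lambda>ws. norm (\<Sum>v\<in>V. ep p (\<Sum>i\<in>I. \<xi> i * constraint ws v i))) \<le> isum V m (\<lambda>_. \<delta> * N)"
      by (intro isum_mono)
    then show ?thesis by (simp add: isum_const card_V card_Vn mult_ac)
  next
    case cross
    obtain S where S: "S \<subseteq> {..<n}" "cols_indep p n (?M (i + 2)) S" "1 / real p ^ card S \<le> \<delta>"
      by (rule rank_comb[of "\<lambda>k. \<xi> (i + 2, k)" k]) (use rng cross in auto)
    have M1: "?M 1 = (\<lambda>_ _. 0)"
      using cross(1) by (simp add: comb_def fun_eq_iff)
    have "isum V m (\<lambda>ws. norm (\<Sum>v\<in>V. ep p (\<Sum>i\<in>I. \<xi> i * constraint ws v i))) \<le> real (card V) ^ (m - 1) * (\<delta> * N ^ 2)"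
    proof (rule isum_slot[OF cross(2)])
      fix ws us :: "(nat \<Rightarrow> int) list"
      assume len: "length ws = i" "length us = m - Suc i"
      \<comment> \<open>\<open>c\<close> gathers the part of the linear phase that is free of slot
        \<open>i\<close>; the zero vector is a placeholder that keeps the positions of the other
        entries.\<close>
      define c where "c t = ?R t + (\<Sum>j\<in>{..<m} - {i}. mv n (?M (j + 2)) ((ws @ (\<lambda>_. 0) # us)!j) t)" for t
      have "norm (\<Sum>v\<in>V. ep p (\<Sum>i\<in>I. \<xi> i * constraint (ws @ w # us) v i))
          = N * of_bool (\<forall>t<n. int p dvd mv n (?M (i + 2)) w t + c t)" for w
      proof -
        have other: "(ws @ w # us)!j = (ws @ (\<lambda>_. 0) # us)!j" if "j \<noteq> i" for j
          using that len by (auto simp: nth_append nth_Cons split: nat.split)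
        have "(\<Sum>j<m. mv n (?M (j + 2)) ((ws @ w # us)!j) t)
          = mv n (?M (i + 2)) w t + (\<Sum>j\<in>{..<m} - {i}. mv n (?M (j + 2)) ((ws @ (\<lambda>_. 0) # us)!j) t)" for t
        proof -
          have "(\<Sum>j\<in>{..<m} - {i}. mv n (?M (j + 2)) ((ws @ w # us)!j) t)
              = (\<Sum>j\<in>{..<m} - {i}. mv n (?M (j + 2)) ((ws @ (\<lambda>_. 0) # us)!j) t)"
            by (intro sum.cong refl) (simp add: other)
          moreover have "(ws @ w # us)!i = w" using len by (simp add: nth_append)
          ultimately show ?thesis
            using cross(2) by (subst sum.remove[of _ i]) simp_all
        qed
        then have "(\<Sum>i\<in>I. \<xi> i * constraint (ws @ w # us) v i) = dot n v (\<lambda>t. mv n (?M (i + 2)) w t + c t)" for v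
          unfolding ph M1 by (simp add: c_def bil_def mv_def dot_def algebra_simps)
        then show ?thesis
          by (simp add: ep_sum_dot[OF p_pos] norm_mult norm_power)
      qed
      then have "(\<Sum>w\<in>V. norm (\<Sum>v\<in>V. ep p (\<Sum>i\<in>I. \<xi> i * constraint (ws @ w # us) v i)))
          = N * real (card {w \<in> V. \<forall>t<n. int p dvd mv n (?M (i + 2)) w t + c t})"
        by (simp add: sum_distrib_left[symmetric] of_bool_def sum.If_cases Int_def)
      also have "\<dots> \<le> N * (N * (1 / real p ^ card S))"
      proof (rule mult_left_mono)
        have "real (card {w \<in> V. \<forall>t<n. int p dvd mv n (?M (i + 2)) w t + c t} * p ^ card S) \<le> real (p ^ n)"
          using card_affine_solutions[OF p_pos S(1,2), of c] by (intro of_nat_mono)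
        then show "real (card {w \<in> V. \<forall>t<n. int p dvd mv n (?M (i + 2)) w t + c t}) \<le> N * (1 / real p ^ card S)"
          using p_pos by (simp add: field_simps)
      qed simp
      also have "\<dots> \<le> N * (N * \<delta>)"
        using S(3) by (intro mult_left_mono) auto
      finally show "(\<Sum>w\<in>V. norm (\<Sum>v\<in>V. ep p (\<Sum>i\<in>I. \<xi> i * constraint (ws @ w # us) v i))) \<le> \<delta> * N ^ 2"
        by (simp add: power2_eq_square mult_ac)
    qed
    also have "\<dots> = \<delta> * N ^ (m - 1 + 2)"
      unfolding card_V power_add by (simp add: mult_ac)
    also have "m - 1 + 2 = m + 1" using cross(2) by simp
    finally show ?thesis .
  next
    case lin
    have M0: "?M 1 = (\<lambda>_ _. 0)" "\<And>j. j < m \<Longrightarrow> ?M (j + 2) = (\<lambda>_ _. 0)"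
      using lin(1,2) by (simp_all add: comb_def fun_eq_iff)
    have "\<not> (\<forall>t<n. int p dvd ?R t)"
    proof
      assume "\<forall>t<n. int p dvd ?R t"
      then have "\<xi> (0, k) mod int p = 0"
        using quadratic_factor.lin[OF quadratic_factor_axioms] lin(3)
        unfolding is_linear_factor_def lin_indep_list_def by (auto simp: mod_eq_0_iff_dvd)
      then show False using rng[of 0 k] lin(4) by simp
    qed
    moreover have "(\<Sum>i\<in>I. \<xi> i * constraint ws v i) = dot n v ?R" for ws v
      using M0 unfolding ph by (simp add: bil_def mv_def dot_def)
    ultimately have "norm (\<Sum>v\<in>V. ep p (\<Sum>i\<in>I. \<xi> i * constraint ws v i)) = 0" for ws
      using ep_sum_dot[OF p_pos, of n ?R] by simp
    then show ?thesis by (simp add: isum_const \<delta>_nonneg)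
  qed
qed

lemma finite_Ifull: "finite (Ifull m)" by (simp add: Ifull_def)

text \<open>The \<open>p ^ card I\<close> frequencies are paid for by the normalisation in
  \<open>dev\<close>, so the number of conditions does not enter the bound.\<close>

lemma isum_dev:
  assumes I: "I \<subseteq> Ifull m"
  shows "isum V m (dev I) \<le> \<delta> * N ^ (m + 1)"
proof -
  have fin: "finite I" using I finite_Ifull finite_subset by blast
  have L: "finite (Vset p I)" "card (Vset p I) = p ^ card I"
    using card_Vset[OF fin] by auto
  have "isum V m (dev I) = (\<Sum>\<xi>\<in>Vset p I - {\<lambda>_. 0}. isum V m (\<lambda>ws. norm (\<Sum>v\<in>V. ep p (\<Sum>i\<in>I. \<xi> i * constraint ws v i)))) / real p ^ card I"
    unfolding dev_def isum_divide isum_sum ..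
  also have "\<dots> \<le> (\<Sum>\<xi>\<in>Vset p I - {\<lambda>_. 0}. \<delta> * N ^ (m + 1)) / real p ^ card I"
    by (intro divide_right_mono sum_mono isum_norm_phase[OF I]) auto
  also have "\<dots> \<le> (\<Sum>\<xi>\<in>Vset p I. \<delta> * N ^ (m + 1)) / real p ^ card I"
    using L \<delta>_nonneg by (intro divide_right_mono sum_mono2) auto
  also have "\<dots> = \<delta> * N ^ (m + 1)"
    using L p_pos by simp
  finally show ?thesis .
qed

end

section \<open>Counts of atoms, parallelepipeds and decompositions\<close>

lemma Vn_eq_iff_dvd:
  assumes "u \<in> Vn p m"
  shows "(\<lambda>k. if k < m then g k mod int p else 0) = u \<longleftrightarrow> (\<forall>k<m. int p dvd g k - u k)"
proof -
  have "(\<lambda>k. if k < m then g k mod int p else 0) = u \<longleftrightarrow> (\<forall>k<m. g k mod int p = u k mod int p)"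
    using assms by (auto simp: Vn_def fun_eq_iff)
  then show ?thesis by (simp add: mod_eq_dvd_iff)
qed

text \<open>For choosing vertices one at a time: \<chi> marks the admissible partial configurations
  \<open>y\<close>, \<open>c y\<close> counts the continuations of \<open>y\<close>, and \<nu> is
  the expected count.\<close>

lemma weighted_sum_deviation:
  assumes "\<And>y. y \<in> Y \<Longrightarrow> 0 \<le> \<chi> y \<and> \<chi> y \<le> 1" "\<And>y. y \<in> Y \<Longrightarrow> \<bar>c y - \<nu>\<bar> \<le> (E y :: real)"
  shows "\<bar>(\<Sum>y\<in>Y. \<chi> y * c y) - \<nu> * (\<Sum>y\<in>Y. \<chi> y)\<bar> \<le> (\<Sum>y\<in>Y. E y)"
proof -
  have "(\<Sum>y\<in>Y. \<chi> y * c y) - \<nu> * (\<Sum>y\<in>Y. \<chi> y) = (\<Sum>y\<in>Y. \<chi> y * (c y - \<nu>))"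
    by (simp add: sum_distrib_left sum_subtractf algebra_simps)
  also have "\<bar>\<dots>\<bar> \<le> (\<Sum>y\<in>Y. \<bar>\<chi> y * (c y - \<nu>)\<bar>)" by (rule sum_abs)
  also have "\<dots> \<le> (\<Sum>y\<in>Y. E y)"
  proof (rule sum_mono)
    fix y assume y: "y \<in> Y"
    have "\<bar>\<chi> y * (c y - \<nu>)\<bar> \<le> 1 * \<bar>c y - \<nu>\<bar>"
      unfolding abs_mult using assms(1)[OF y] by (intro mult_right_mono) auto
    then show "\<bar>\<chi> y * (c y - \<nu>)\<bar> \<le> E y" using assms(2)[OF y] by simp
  qed
  finally show ?thesis .
qed

context quadratic_factor
begin

text \<open>\<open>inB\<close> and \<open>inQ\<close> state membership by divisibility; unlike
  \<open>atom\<close> and \<open>qpre\<close> they make sense for unreduced vectors such as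
  \<open>h + x\<close>.\<close>

definition inB :: "(nat \<Rightarrow> int) \<times> (nat \<Rightarrow> int) \<Rightarrow> (nat \<Rightarrow> int) \<Rightarrow> bool" where
  "inB d x \<longleftrightarrow> (\<forall>k<l. int p dvd dot n x (rs!k) - fst d k) \<and> (\<forall>k<q. int p dvd bil n (Ms!k) x x - snd d k)"

definition inQ :: "(nat \<Rightarrow> int) \<Rightarrow> (nat \<Rightarrow> int) \<Rightarrow> (nat \<Rightarrow> int) \<Rightarrow> bool" where
  "inQ u x y \<longleftrightarrow> (\<forall>k<q. int p dvd bil n (Ms!k) x y - u k)"

lemma atom_iff:
  assumes "d \<in> Vn p l \<times> Vn p q"
  shows "x \<in> atom p n rs Ms d \<longleftrightarrow> x \<in> V \<and> inB d x"
  using assms Vn_eq_iff_dvd[of "fst d" p l "\<lambda>k. dot n x (rs!k)"]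
    Vn_eq_iff_dvd[of "snd d" p q "\<lambda>k. bil n (Ms!k) x x"]
  unfolding atom_def beta_B_def beta_L_def beta_Q_def dotp_eq bilin_eq inB_def
  by (cases d) auto

lemma qpre_iff: "u \<in> Vn p q \<Longrightarrow> (x, y) \<in> qpre p n Ms u \<longleftrightarrow> x \<in> V \<and> y \<in> V \<and> inQ u x y"
  unfolding qpre_def beta_Q_def bilin_eq inQ_def by (simp add: Vn_eq_iff_dvd)

lemma inB_red: "inB d (red p n x) \<longleftrightarrow> inB d x"
  unfolding inB_def
  using dvd_diff_cong[OF dvd_dot_red] dvd_diff_cong[OF dvd_bil_red] by metis

lemma inQ_red_left: "inQ u (red p n x) y \<longleftrightarrow> inQ u x y"
  unfolding inQ_def using dvd_diff_cong[OF dvd_bil_red_left] by metis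

lemma inQ_red_right: "inQ u x (red p n y) \<longleftrightarrow> inQ u x y"
  unfolding inQ_def using dvd_diff_cong[OF dvd_bil_red_right] by metis

lemma inQ_commute: "inQ u x y \<longleftrightarrow> inQ u y x"
  unfolding inQ_def using bil_commute[OF symm_Ms] by auto

text \<open>The expected number of points of an atom with prescribed pairings against
  \<open>m\<close> given vectors: \<open>l + q\<close> conditions for the atom and \<open>q\<close>
  for each vector.\<close>

definition \<nu> :: "nat \<Rightarrow> real" where
  "\<nu> m = N / real p ^ (l + (m + 1) * q)"

abbreviation "ext_dev ws \<equiv> dev (Ifull (length ws)) ws"

lemma \<nu>_nonneg: "0 \<le> \<nu> m" by (simp add: \<nu>_def)

lemma \<nu>_le: "\<nu> m \<le> N"
proof -
  have "1 \<le> real p ^ (l + (m + 1) * q)" using p_pos by (intro one_le_power) simp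
  then show ?thesis
    using N_pos divide_left_mono[of 1 "real p ^ (l + (m + 1) * q)" N] by (simp add: \<nu>_def p_pos)
qed

lemma card_Ifull: "card (Ifull m) = l + (m + 1) * q"
proof -
  have "card (Ifull m) = card ({0::nat} \<times> {..<l}) + (card ({1::nat} \<times> {..<q}) + card ((\<lambda>j. j + 2) ` {..<m} \<times> {..<q}))"
    unfolding Ifull_def by (subst card_Un_disjoint, simp, simp, fastforce)+ simp
  then show ?thesis by (simp add: card_cartesian_product card_image inj_on_def)
qed

lemma count_extensions:
  assumes "length us = length ws"
  shows "\<bar>(\<Sum>v\<in>V. of_bool (inB d v \<and> (\<forall>(u, w)\<in>set (zip us ws). inQ u v w))) - \<nu> (length ws)\<bar> \<le> ext_dev ws"
proof -
  let ?T = "\<lambda>(j, k). if j = 0 then fst d k else if j = 1 then snd d k else (us!(j - 2)) k"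
  have "(\<forall>i\<in>Ifull (length ws). int p dvd constraint ws v i - ?T i)
      \<longleftrightarrow> inB d v \<and> (\<forall>(u, w)\<in>set (zip us ws). inQ u v w)" for v
    using assms unfolding Ifull_def ball_Un inB_def inQ_def set_zip constraint_def by fastforce
  then show ?thesis
    using count_deviation[OF finite_Ifull, of "length ws" ws ?T] by (simp add: card_Ifull \<nu>_def)
qed

text \<open>Counting \<open>h\<close> instead of the vertex \<open>v = h + x\<close> moves the
  target of the pairing with \<open>w\<close> to \<open>bil n (Ms!k) x w\<close>. The targets thus
  vary with \<open>x\<close> and \<open>w\<close>, which the uniformity of \<open>dev\<close>
  permits.\<close>

lemma count_shifted_extensions:
  "\<bar>(\<Sum>h\<in>V. of_bool (inB d (h + x) \<and> (\<forall>w\<in>set ws. inQ (\<lambda>_. 0) h w))) - \<nu> (length ws)\<bar> \<le> ext_dev ws"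
proof -
  let ?us = "map (\<lambda>w k. bil n (Ms!k) x w) ws"
  let ?F = "\<lambda>v. of_bool (inB d v \<and> (\<forall>(u, w)\<in>set (zip ?us ws). inQ u v w)) :: real"
  have "?F (red p n (h + x)) = of_bool (inB d (h + x) \<and> (\<forall>w\<in>set ws. inQ (\<lambda>_. 0) h w))" for h
    by (simp add: inB_red inQ_red_left zip_map1 zip_same_conv_map) (simp add: inQ_def bil_simps)
  then show ?thesis
    using count_extensions[of ?us ws d] sum_Vn_shift[OF p_pos, of ?F n x] by simp
qed

lemma sum_ext_dev:
  "ext_dev [] \<le> \<delta> * N"
  "(\<Sum>a\<in>V. ext_dev [a]) \<le> \<delta> * N ^ 2"
  "(\<Sum>a\<in>V. \<Sum>b\<in>V. ext_dev [a, b]) \<le> \<delta> * N ^ 3"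
  "(\<Sum>a\<in>V. \<Sum>b\<in>V. \<Sum>c\<in>V. \<Sum>d\<in>V. ext_dev [a, b, c, d]) \<le> \<delta> * N ^ 5"
  "(\<Sum>a\<in>V. \<Sum>b\<in>V. \<Sum>c\<in>V. \<Sum>d\<in>V. \<Sum>e\<in>V. ext_dev [a, b, c, d, e]) \<le> \<delta> * N ^ 6"
  using isum_dev[of "Ifull 0" 0] isum_dev[of "Ifull 1" 1] isum_dev[of "Ifull 2" 2]
    isum_dev[of "Ifull 4" 4] isum_dev[of "Ifull 5" 5]
  by (simp_all add: eval_nat_numeral)

section \<open>Sizes of atoms, of level sets and of the set of parallelepipeds\<close>

lemma card_atom:
  assumes "d \<in> Vn p l \<times> Vn p q"
  shows "\<bar>real (card (atom p n rs Ms d)) - N / real p ^ (l + q)\<bar> \<le> \<delta> * N"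
proof -
  have "atom p n rs Ms d = {x \<in> V. inB d x}" using atom_iff[OF assms] by auto
  then have "real (card (atom p n rs Ms d)) = (\<Sum>v\<in>V. of_bool (inB d v))"
    by (simp add: of_bool_def sum.If_cases Int_def)
  then show ?thesis
    using count_extensions[of "[]" "[]" d] sum_ext_dev(1) by (simp add: \<nu>_def)
qed

text \<open>Only row 2 occurs here, as no atom condition is imposed. For a single \<open>y\<close>
  the count can be far from its mean, for instance at \<open>y = 0\<close> when
  \<open>q > 0\<close>, so the error is estimated after summing over \<open>y\<close>.\<close>

lemma card_qpre:
  assumes "u \<in> Vn p q"
  shows "\<bar>real (card (qpre p n Ms u)) - N ^ 2 / real p ^ q\<bar> \<le> \<delta> * N ^ 2"
proof -
  let ?I = "{2::nat} \<times> {..<q}"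
  have sub: "?I \<subseteq> Ifull 1" by (auto simp: Ifull_def)
  have fin: "finite ?I" by simp
  have "qpre p n Ms u = (SIGMA x:V. {y \<in> V. inQ u x y})" using qpre_iff[OF assms] by auto
  then have "real (card (qpre p n Ms u)) = (\<Sum>y\<in>V. \<Sum>v\<in>V. of_bool (inQ u v y))"
    by (simp add: of_bool_def sum.If_cases Int_def inQ_commute)
  also have "\<bar>\<dots> - N ^ 2 / real p ^ q\<bar> = \<bar>\<Sum>y\<in>V. ((\<Sum>v\<in>V. of_bool (inQ u v y)) - N / real p ^ card ?I)\<bar>"
    by (simp add: sum_subtractf card_Vn power2_eq_square card_cartesian_product)
  also have "\<dots> \<le> (\<Sum>y\<in>V. \<bar>(\<Sum>v\<in>V. of_bool (inQ u v y)) - N / real p ^ card ?I\<bar>)"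
    by (rule sum_abs)
  also have "\<dots> \<le> (\<Sum>y\<in>V. dev ?I [y])"
  proof (rule sum_mono)
    fix y
    have "(\<forall>i\<in>?I. int p dvd constraint [y] v i - (case i of (j, k) \<Rightarrow> u k)) \<longleftrightarrow> inQ u v y" for v
      by (auto simp: constraint_def inQ_def)
    then show "\<bar>(\<Sum>v\<in>V. of_bool (inQ u v y)) - N / real p ^ card ?I\<bar> \<le> dev ?I [y]"
      using count_deviation[OF fin, of "[y]" "\<lambda>(j, k). u k"] by simp
  qed
  also have "\<dots> \<le> \<delta> * N ^ 2"
    using isum_dev[OF sub] by (simp add: eval_nat_numeral)
  finally show ?thesis .
qed

text \<open>The conditions are grouped by the vertex they are imposed on, so that the vertices \<open>x\<close>, \<open>x + h1\<close>,
  \<open>x + h2\<close>, \<open>x + h3\<close> can be counted one after the other.\<close>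

definition parallelepiped :: "(nat \<Rightarrow> int) \<times> (nat \<Rightarrow> int) \<Rightarrow> (nat \<Rightarrow> int) \<Rightarrow> (nat \<Rightarrow> int) \<Rightarrow> (nat \<Rightarrow> int) \<Rightarrow> (nat \<Rightarrow> int) \<Rightarrow> bool" where
  "parallelepiped b x h1 h2 h3 \<longleftrightarrow> inB b x \<and> inB b (h1 + x) \<and> (inB b (h2 + x) \<and> inQ (\<lambda>_. 0) h2 h1)
     \<and> (inB b (h3 + x) \<and> inQ (\<lambda>_. 0) h3 h1 \<and> inQ (\<lambda>_. 0) h3 h2)"

text \<open>The four vertices carry \<open>l + q\<close>, \<open>l + q\<close>,
  \<open>l + 2 q\<close> and \<open>l + 3 q\<close> conditions. Each of the four replacements of a
  count by its mean costs at most \<open>\<delta> * N ^ 4\<close>.\<close>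

lemma count_parallelepipeds:
  "\<bar>(\<Sum>x\<in>V. \<Sum>h1\<in>V. \<Sum>h2\<in>V. \<Sum>h3\<in>V. of_bool (parallelepiped b x h1 h2 h3)) - \<nu> 0 * \<nu> 0 * \<nu> 1 * \<nu> 2\<bar> \<le> 4 * \<delta> * N ^ 4"
proof -
  let ?c0 = "\<lambda>x. of_bool (inB b x) :: real"
  let ?c1 = "\<lambda>x h1. of_bool (inB b (h1 + x)) :: real"
  let ?c2 = "\<lambda>x h1 h2. of_bool (inB b (h2 + x) \<and> inQ (\<lambda>_. 0) h2 h1) :: real"
  let ?c3 = "\<lambda>x h1 h2 h3. of_bool (inB b (h3 + x) \<and> inQ (\<lambda>_. 0) h3 h1 \<and> inQ (\<lambda>_. 0) h3 h2) :: real"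
  \<comment> \<open>\<open>U3\<close>, \<open>U2\<close>, \<open>U1\<close>, \<open>U0\<close> count
    the partial configurations with four, three, two and one chosen vertices.\<close>
  define U3 where "U3 = (\<Sum>x\<in>V. \<Sum>h1\<in>V. \<Sum>h2\<in>V. (?c0 x * ?c1 x h1 * ?c2 x h1 h2) * (\<Sum>h3\<in>V. ?c3 x h1 h2 h3))"
  define U2 where "U2 = (\<Sum>x\<in>V. \<Sum>h1\<in>V. (?c0 x * ?c1 x h1) * (\<Sum>h2\<in>V. ?c2 x h1 h2))"
  define U1 where "U1 = (\<Sum>x\<in>V. ?c0 x * (\<Sum>h1\<in>V. ?c1 x h1))"
  define U0 where "U0 = (\<Sum>x\<in>V. ?c0 x)"
  have eq: "(\<Sum>x\<in>V. \<Sum>h1\<in>V. \<Sum>h2\<in>V. \<Sum>h3\<in>V. of_bool (parallelepiped b x h1 h2 h3)) = U3"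
    unfolding U3_def parallelepiped_def sum_distrib_left of_bool_conj by (simp only: mult_ac)
  have 0: "\<bar>U0 - \<nu> 0\<bar> \<le> \<delta> * N"
    using count_extensions[of "[]" "[]" b] sum_ext_dev(1) by (simp add: U0_def)
  have "\<bar>U1 - \<nu> 0 * U0\<bar> \<le> (\<Sum>x\<in>V. ext_dev [])"
    unfolding U1_def U0_def
    by (rule weighted_sum_deviation) (use count_shifted_extensions[of b _ "[]"] in auto)
  also have "\<dots> \<le> \<delta> * N ^ 2"
    using sum_ext_dev(1) mult_left_mono[OF sum_ext_dev(1), of N] by (simp add: card_Vn power2_eq_square mult_ac)
  finally have 1: "\<bar>U1 - \<nu> 0 * U0\<bar> \<le> \<delta> * N ^ 2" .
  have "\<bar>U2 - \<nu> 1 * U1\<bar> \<le> (\<Sum>y\<in>V \<times> V. ext_dev [snd y])"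
  proof -
    have "U2 = (\<Sum>y\<in>V \<times> V. (?c0 (fst y) * ?c1 (fst y) (snd y)) * (\<Sum>h2\<in>V. ?c2 (fst y) (snd y) h2))"
      by (simp only: U2_def sum.cartesian_product case_prod_unfold)
    moreover have "U1 = (\<Sum>y\<in>V \<times> V. ?c0 (fst y) * ?c1 (fst y) (snd y))"
      by (simp only: U1_def sum_distrib_left sum.cartesian_product case_prod_unfold)
    moreover have "\<bar>(\<Sum>h2\<in>V. ?c2 x h1 h2) - \<nu> 1\<bar> \<le> ext_dev [h1]" for x h1
      using count_shifted_extensions[of b x "[h1]"] by simp
    ultimately show ?thesis
      by (simp only:) (rule weighted_sum_deviation, auto)
  qed
  also have "\<dots> = (\<Sum>x\<in>V. \<Sum>a\<in>V. ext_dev [a])"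
    unfolding sum.cartesian_product by (simp add: case_prod_beta)
  also have "\<dots> \<le> \<delta> * N ^ 3"
    using mult_left_mono[OF sum_ext_dev(2), of N] by (simp add: card_Vn eval_nat_numeral mult_ac)
  finally have 2: "\<bar>U2 - \<nu> 1 * U1\<bar> \<le> \<delta> * N ^ 3" .
  have "\<bar>U3 - \<nu> 2 * U2\<bar> \<le> (\<Sum>y\<in>V \<times> V \<times> V. ext_dev [fst (snd y), snd (snd y)])"
  proof -
    have "U3 = (\<Sum>y\<in>V \<times> V \<times> V. (?c0 (fst y) * ?c1 (fst y) (fst (snd y)) * ?c2 (fst y) (fst (snd y)) (snd (snd y)))
        * (\<Sum>h3\<in>V. ?c3 (fst y) (fst (snd y)) (snd (snd y)) h3))"
      by (simp only: U3_def sum.cartesian_product case_prod_unfold)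
    moreover have "U2 = (\<Sum>y\<in>V \<times> V \<times> V. ?c0 (fst y) * ?c1 (fst y) (fst (snd y)) * ?c2 (fst y) (fst (snd y)) (snd (snd y)))"
      by (simp only: U2_def sum_distrib_left sum.cartesian_product case_prod_unfold)
    moreover have "\<bar>(\<Sum>h3\<in>V. ?c3 x h1 h2 h3) - \<nu> 2\<bar> \<le> ext_dev [h1, h2]" for x h1 h2
      using count_shifted_extensions[of b x "[h1, h2]"] by (simp add: eval_nat_numeral)
    ultimately show ?thesis
      by (simp only:) (rule weighted_sum_deviation, auto)
  qed
  also have "\<dots> = (\<Sum>x\<in>V. \<Sum>a\<in>V. \<Sum>b\<in>V. ext_dev [a, b])"
    unfolding sum.cartesian_product by (simp add: case_prod_beta)
  also have "\<dots> \<le> \<delta> * N ^ 4"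
    using mult_left_mono[OF sum_ext_dev(3), of N] by (simp add: card_Vn eval_nat_numeral mult_ac)
  finally have 3: "\<bar>U3 - \<nu> 2 * U2\<bar> \<le> \<delta> * N ^ 4" .
  \<comment> \<open>An error made at an early vertex is carried through each later one by the
    trivial bound \<open>\<nu> m \<le> N\<close>.\<close>
  have step: "\<bar>\<nu> m * A - \<nu> m * B\<bar> \<le> \<delta> * N ^ Suc k" if "\<bar>A - B\<bar> \<le> \<delta> * N ^ k" for A B m k
  proof -
    have "\<bar>\<nu> m * A - \<nu> m * B\<bar> = \<nu> m * \<bar>A - B\<bar>"
      using \<nu>_nonneg[of m] by (simp add: right_diff_distrib[symmetric] abs_mult)
    also have "\<dots> \<le> N * (\<delta> * N ^ k)"
      using \<nu>_nonneg[of m] \<nu>_le[of m] that by (intro mult_mono) auto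
    finally show ?thesis by (simp add: mult_ac)
  qed
  have a1: "\<bar>\<nu> 2 * U2 - \<nu> 2 * (\<nu> 1 * U1)\<bar> \<le> \<delta> * N ^ 4"
    using step[OF 2] by (simp add: eval_nat_numeral)
  have a2: "\<bar>\<nu> 2 * (\<nu> 1 * U1) - \<nu> 2 * (\<nu> 1 * (\<nu> 0 * U0))\<bar> \<le> \<delta> * N ^ 4"
    using step[OF step[OF 1]] by (simp add: eval_nat_numeral)
  have a3: "\<bar>\<nu> 2 * (\<nu> 1 * (\<nu> 0 * U0)) - \<nu> 2 * (\<nu> 1 * (\<nu> 0 * \<nu> 0))\<bar> \<le> \<delta> * N ^ 4"
    using step[OF step[OF step[of U0 "\<nu> 0" 1]]] 0 by (simp add: eval_nat_numeral)
  have "\<nu> 2 * (\<nu> 1 * (\<nu> 0 * \<nu> 0)) = \<nu> 0 * \<nu> 0 * \<nu> 1 * \<nu> 2" by (simp add: mult_ac)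
  then show ?thesis
    unfolding eq using 3 a1 a2 a3 by linarith
qed

text \<open>The inverse of 2 modulo \<open>p\<close>. It turns the vanishing of
  \<open>2 * bil n M v h + bil n M h h\<close> into a prescribed value of
  \<open>bil n M v h\<close>, which is the form of condition that \<open>inQ\<close>
  expresses.\<close>

definition half :: int where "half = (int p + 1) div 2"

lemma half: "2 * half = int p + 1"
  using odd_p unfolding half_def by presburger

lemma half_dvd: "int p dvd t - (- (half * s)) \<longleftrightarrow> int p dvd 2 * t + s"
proof -
  have "2 * (t + half * s) = (2 * t + s) + int p * s"
  proof -
    have "2 * (t + half * s) = 2 * t + (2 * half) * s" by (simp add: algebra_simps)
    then show ?thesis unfolding half by (simp add: algebra_simps)
  qed
  moreover have "coprime (int p) 2" using odd_p by simp
  then have "int p dvd 2 * (t + half * s) \<longleftrightarrow> int p dvd t + half * s"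
    by (simp only: coprime_dvd_mult_right_iff)
  moreover have "int p dvd (2 * t + s) + int p * s \<longleftrightarrow> int p dvd 2 * t + s"
    by (rule dvd_add_left_iff) simp
  ultimately show ?thesis by (simp only: diff_minus_eq_add)
qed

text \<open>What the parallelepiped leaves open for \<open>v = x1\<close> with its own direction
  \<open>h = x2 - x1\<close>, and likewise for \<open>y1\<close>. Pairing \<open>v\<close> with
  \<open>x = x1 + y1 + z1\<close> must give the sum \<open>u\<close> of the values prescribed
  against the three points. Since \<open>v\<close> and \<open>h + v\<close> lie in the same atom,
  the pairing with \<open>h\<close> is minus half the value of the form at \<open>h\<close>. The
  other two directions pair to 0 because both of their endpoints have the same prescribed pairing
  with \<open>v\<close>.\<close>

definition base_point :: "(nat \<Rightarrow> int) \<times> (nat \<Rightarrow> int) \<Rightarrow> (nat \<Rightarrow> int) \<Rightarrow> (nat \<Rightarrow> int) \<Rightarrow> (nat \<Rightarrow> int) \<Rightarrow> (nat \<Rightarrow> int) \<Rightarrow> (nat \<Rightarrow> int) \<Rightarrow> (nat \<Rightarrow> int) \<Rightarrow> bool" where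
  "base_point da u x h h' h'' v \<longleftrightarrow> inB da v \<and> inQ u v x \<and> inQ (\<lambda>k. - (half * bil n (Ms!k) h h)) v h
     \<and> inQ (\<lambda>_. 0) v h' \<and> inQ (\<lambda>_. 0) v h''"

text \<open>\<open>v\<close> is paired with four vectors and \<open>w\<close> with these and
  \<open>v\<close>, whence \<open>\<nu> 4 * \<nu> 5\<close>. The absolute value stands inside the
  outer sums because such an L1 bound survives multiplication by any bounded function of
  \<open>x, h1, h2, h3\<close>.\<close>

lemma count_decompositions:
  "(\<Sum>x\<in>V. \<Sum>h1\<in>V. \<Sum>h2\<in>V. \<Sum>h3\<in>V. \<bar>(\<Sum>v\<in>V. \<Sum>w\<in>V.
      of_bool (base_point da u x h1 h2 h3 v) * of_bool (base_point db u' x h2 h1 h3 w \<and> inQ dab w v)) - \<nu> 4 * \<nu> 5\<bar>)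
    \<le> 2 * \<delta> * N ^ 6"
proof -
  let ?X = "\<lambda>x h1 h2 h3 v. of_bool (base_point da u x h1 h2 h3 v) :: real"
  let ?Y = "\<lambda>x h1 h2 h3 v w. of_bool (base_point db u' x h2 h1 h3 w \<and> inQ dab w v) :: real"
  have Y: "\<bar>(\<Sum>w\<in>V. ?Y x h1 h2 h3 v w) - \<nu> 5\<bar> \<le> ext_dev [x, h1, h2, h3, v]" for x h1 h2 h3 v
    using count_extensions[of "[u', \<lambda>_. 0, \<lambda>k. - (half * bil n (Ms!k) h2 h2), \<lambda>_. 0, dab]" "[x, h1, h2, h3, v]" db]
    by (simp add: base_point_def eval_nat_numeral conj_ac)
  have X: "\<bar>(\<Sum>v\<in>V. ?X x h1 h2 h3 v) - \<nu> 4\<bar> \<le> ext_dev [x, h1, h2, h3]" for x h1 h2 h3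
    using count_extensions[of "[u, \<lambda>k. - (half * bil n (Ms!k) h1 h1), \<lambda>_. 0, \<lambda>_. 0]" "[x, h1, h2, h3]" da]
    by (simp add: base_point_def eval_nat_numeral conj_ac)
  have "\<bar>(\<Sum>v\<in>V. \<Sum>w\<in>V. ?X x h1 h2 h3 v * ?Y x h1 h2 h3 v w) - \<nu> 4 * \<nu> 5\<bar>
      \<le> (\<Sum>v\<in>V. ext_dev [x, h1, h2, h3, v]) + N * ext_dev [x, h1, h2, h3]" for x h1 h2 h3
  proof -
    have "\<bar>(\<Sum>v\<in>V. ?X x h1 h2 h3 v * (\<Sum>w\<in>V. ?Y x h1 h2 h3 v w)) - \<nu> 5 * (\<Sum>v\<in>V. ?X x h1 h2 h3 v)\<bar>
        \<le> (\<Sum>v\<in>V. ext_dev [x, h1, h2, h3, v])"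
      by (rule weighted_sum_deviation) (use Y in auto)
    moreover have "\<bar>\<nu> 5 * (\<Sum>v\<in>V. ?X x h1 h2 h3 v) - \<nu> 5 * \<nu> 4\<bar> \<le> N * ext_dev [x, h1, h2, h3]"
      unfolding right_diff_distrib[symmetric] abs_mult
      using X \<nu>_nonneg[of 5] \<nu>_le[of 5] by (intro mult_mono) auto
    ultimately show ?thesis
      unfolding sum_distrib_left[symmetric] mult.commute[of "\<nu> 4"] by linarith
  qed
  then have "(\<Sum>x\<in>V. \<Sum>h1\<in>V. \<Sum>h2\<in>V. \<Sum>h3\<in>V. \<bar>(\<Sum>v\<in>V. \<Sum>w\<in>V. ?X x h1 h2 h3 v * ?Y x h1 h2 h3 v w) - \<nu> 4 * \<nu> 5\<bar>)
     \<le> (\<Sum>x\<in>V. \<Sum>h1\<in>V. \<Sum>h2\<in>V. \<Sum>h3\<in>V. (\<Sum>v\<in>V. ext_dev [x, h1, h2, h3, v]) + N * ext_dev [x, h1, h2, h3])"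
    by (intro sum_mono)
  also have "\<dots> = (\<Sum>x\<in>V. \<Sum>h1\<in>V. \<Sum>h2\<in>V. \<Sum>h3\<in>V. \<Sum>v\<in>V. ext_dev [x, h1, h2, h3, v])
     + N * (\<Sum>x\<in>V. \<Sum>h1\<in>V. \<Sum>h2\<in>V. \<Sum>h3\<in>V. ext_dev [x, h1, h2, h3])"
    by (simp add: sum.distrib sum_distrib_left)
  also have "\<dots> \<le> \<delta> * N ^ 6 + N * (\<delta> * N ^ 5)"
    using sum_ext_dev(4,5) by (intro add_mono mult_left_mono) auto
  also have "\<dots> = 2 * \<delta> * N ^ 6"
    by (simp add: eval_nat_numeral)
  finally show ?thesis .
qed

end

section \<open>Change of variables\<close>

lemma sum_Vn_shift_minus:
  assumes "p > 0"
  shows "(\<Sum>x\<in>Vn p n. F (red p n (x - w))) = (\<Sum>x\<in>Vn p n. F x)"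
  using sum_Vn_shift[OF assms, of F n "- w"] by simp

lemma red_red: "red p n (red p n x) = red p n x"
  by (simp add: red_def fun_eq_iff)

lemma vadd_red: "vadd p (red p n x) (red p n y) = red p n (x + y)"
  by (auto simp: vadd_def red_def fun_eq_iff mod_simps)

lemma sum_subset_of_bool: "finite V \<Longrightarrow> A \<subseteq> V \<Longrightarrow> (\<Sum>x\<in>A. F x) = (\<Sum>x\<in>V. of_bool (x \<in> A) * (F x :: real))"
  by (rule sum.mono_neutral_cong_left) auto

definition cube_prod :: "nat \<Rightarrow> nat \<Rightarrow> ((nat \<Rightarrow> int) \<Rightarrow> real) \<Rightarrow> (nat \<Rightarrow> int) \<Rightarrow> (nat \<Rightarrow> int) \<Rightarrow> (nat \<Rightarrow> int) \<Rightarrow> (nat \<Rightarrow> int) \<Rightarrow> real" where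
  "cube_prod p n f x h1 h2 h3 =
     f (red p n x) * f (red p n (x + h1)) * f (red p n (x + h2)) * f (red p n (x + (h1 + h2)))
     * f (red p n (x + h3)) * f (red p n (x + (h1 + h3))) * f (red p n (x + (h2 + h3))) * f (red p n (x + (h1 + h2 + h3)))"

lemma u3_sum_eq:
  assumes "p > 0"
  shows "u3_sum p n f = (\<Sum>x\<in>Vn p n. \<Sum>h1\<in>Vn p n. \<Sum>h2\<in>Vn p n. \<Sum>h3\<in>Vn p n. cube_prod p n f x h1 h2 h3)"
  unfolding u3_sum_def
proof (intro sum.cong refl)
  fix x h1 h2 h3
  assume V: "x \<in> Vn p n" "h1 \<in> Vn p n" "h2 \<in> Vn p n" "h3 \<in> Vn p n"
  have s0: "smul p 0 h = red p n 0" for h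
    by (auto simp: smul_def red_def fun_eq_iff)
  have s1: "smul p 1 h = red p n h" if "h \<in> Vn p n" for h
    using that by (auto simp: smul_def red_def Vn_def fun_eq_iff)
  have x: "vadd p x y = vadd p (red p n x) y" for y using V by (simp add: red_Vn)
  show "(\<Prod>w1\<in>{0, 1}. \<Prod>w2\<in>{0, 1}. \<Prod>w3\<in>{0, 1}.
      f (vadd p (vadd p (vadd p x (smul p w1 h1)) (smul p w2 h2)) (smul p w3 h3))) = cube_prod p n f x h1 h2 h3"
    unfolding x using V by (simp add: s0 s1 vadd_red cube_prod_def add.assoc)
qed

text \<open>With \<open>h1\<close> and \<open>h2\<close> fixed, the product splits into the face at
  \<open>x\<close> and the face at \<open>x + h3\<close>, so the sum over \<open>x\<close> and
  \<open>h3\<close> is a square. Nonnegativity makes the eighth power of \<open>root 8\<close> give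
  back the sum.\<close>

lemma u3_sum_nonneg:
  assumes "p > 0"
  shows "u3_sum p n f \<ge> 0"
proof -
  let ?V = "Vn p n"
  define g where "g h1 h2 u = f (red p n u) * f (red p n (u + h1)) * f (red p n (u + h2)) * f (red p n (u + (h1 + h2)))" for h1 h2 u
  have "u3_sum p n f = (\<Sum>h1\<in>?V. \<Sum>h2\<in>?V. \<Sum>x\<in>?V. \<Sum>h3\<in>?V. cube_prod p n f x h1 h2 h3)"
    unfolding u3_sum_eq[OF assms]
    by (rule trans[OF sum.swap], rule sum.cong[OF refl], rule sum.swap)
  also have "\<dots> = (\<Sum>h1\<in>?V. \<Sum>h2\<in>?V. \<Sum>x\<in>?V. \<Sum>h3\<in>?V. g h1 h2 x * g h1 h2 (red p n (h3 + x)))"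
    unfolding cube_prod_def g_def red_red_add red_red by (simp only: add_ac mult_ac)
  also have "\<dots> = (\<Sum>h1\<in>?V. \<Sum>h2\<in>?V. (\<Sum>x\<in>?V. g h1 h2 x) ^ 2)"
    by (simp add: sum_distrib_left[symmetric] sum_Vn_shift[OF assms] sum_distrib_right[symmetric] power2_eq_square)
  also have "\<dots> \<ge> 0" by (intro sum_nonneg) simp
  finally show ?thesis .
qed

text \<open>Read \<open>X0\<close>, \<open>Xi\<close>, \<open>Hij\<close> as the values of one form
  at \<open>(x, x)\<close>, \<open>(x, hi)\<close>, \<open>(hi, hj)\<close>. Second differences over
  the cube are \<open>2 * Hij\<close>, and third differences of a quadratic function vanish, so the
  eighth vertex follows from the other seven. Hence the \<open>7 q\<close> in the size of the set of
  parallelepipeds.\<close>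

lemma parallelepiped_quadratic_core:
  fixes P :: int
  assumes two: "\<And>t. P dvd 2 * t \<Longrightarrow> P dvd t"
  shows "P dvd X0 - b \<and> P dvd X0 + 2 * X1 + H11 - b \<and> P dvd X0 + 2 * X2 + H22 - b
      \<and> P dvd X0 + 2 * X1 + 2 * X2 + H11 + H22 + 2 * H12 - b
      \<and> P dvd X0 + 2 * X3 + H33 - b
      \<and> P dvd X0 + 2 * X1 + 2 * X3 + H11 + H33 + 2 * H13 - b
      \<and> P dvd X0 + 2 * X2 + 2 * X3 + H22 + H33 + 2 * H23 - b
      \<and> P dvd X0 + 2 * X1 + 2 * X2 + 2 * X3 + H11 + H22 + H33 + 2 * H12 + 2 * H13 + 2 * H23 - b
   \<longleftrightarrow> P dvd X0 - b \<and> P dvd X0 + 2 * X1 + H11 - b \<and> P dvd X0 + 2 * X2 + H22 - b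
      \<and> P dvd H12 \<and> P dvd X0 + 2 * X3 + H33 - b \<and> P dvd H13 \<and> P dvd H23" (is "?L \<longleftrightarrow> ?R")
proof
  assume ?L
  then obtain e0 e1 e2 e12 e3 e13 e23 where e: "X0 - b = P * e0" "X0 + 2 * X1 + H11 - b = P * e1"
      "X0 + 2 * X2 + H22 - b = P * e2" "X0 + 2 * X1 + 2 * X2 + H11 + H22 + 2 * H12 - b = P * e12"
      "X0 + 2 * X3 + H33 - b = P * e3" "X0 + 2 * X1 + 2 * X3 + H11 + H33 + 2 * H13 - b = P * e13"
      "X0 + 2 * X2 + 2 * X3 + H22 + H33 + 2 * H23 - b = P * e23"
    unfolding dvd_def by blast
  have "2 * H12 = P * (e12 - e1 - e2 + e0)" "2 * H13 = P * (e13 - e1 - e3 + e0)"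
    "2 * H23 = P * (e23 - e2 - e3 + e0)"
    using e by (simp_all add: right_diff_distrib distrib_left)
  then have "P dvd H12 \<and> P dvd H13 \<and> P dvd H23" using two by (metis dvd_triv_left)
  then show ?R using \<open>?L\<close> by blast
next
  assume ?R
  then obtain e0 e1 e2 e12 e3 e13 e23 where e: "X0 - b = P * e0" "X0 + 2 * X1 + H11 - b = P * e1"
      "X0 + 2 * X2 + H22 - b = P * e2" "H12 = P * e12"
      "X0 + 2 * X3 + H33 - b = P * e3" "H13 = P * e13" "H23 = P * e23"
    unfolding dvd_def by blast
  have "X0 + 2 * X1 + 2 * X2 + H11 + H22 + 2 * H12 - b = P * (e1 + e2 - e0 + 2 * e12)"
    "X0 + 2 * X1 + 2 * X3 + H11 + H33 + 2 * H13 - b = P * (e1 + e3 - e0 + 2 * e13)"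
    "X0 + 2 * X2 + 2 * X3 + H22 + H33 + 2 * H23 - b = P * (e2 + e3 - e0 + 2 * e23)"
    "X0 + 2 * X1 + 2 * X2 + 2 * X3 + H11 + H22 + H33 + 2 * H12 + 2 * H13 + 2 * H23 - b
       = P * (e1 + e2 + e3 - 2 * e0 + 2 * e12 + 2 * e13 + 2 * e23)"
    using e by (simp_all add: right_diff_distrib distrib_left)
  then show ?L using \<open>?R\<close> by (metis dvd_triv_left)
qed

text \<open>An affine function on the cube is determined by four vertices, hence the
  \<open>4 l\<close>.\<close>

lemma parallelepiped_linear_core:
  fixes P :: int
  shows "P dvd X0 - b \<and> P dvd X0 + X1 - b \<and> P dvd X0 + X2 - b \<and> P dvd X0 + X1 + X2 - b
      \<and> P dvd X0 + X3 - b \<and> P dvd X0 + X1 + X3 - b \<and> P dvd X0 + X2 + X3 - b \<and> P dvd X0 + X1 + X2 + X3 - b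
   \<longleftrightarrow> P dvd X0 - b \<and> P dvd X0 + X1 - b \<and> P dvd X0 + X2 - b \<and> P dvd X0 + X3 - b" (is "?L \<longleftrightarrow> ?R")
proof
  assume ?R
  then obtain e0 e1 e2 e3 where e: "X0 - b = P * e0" "X0 + X1 - b = P * e1"
      "X0 + X2 - b = P * e2" "X0 + X3 - b = P * e3"
    unfolding dvd_def by blast
  have "X0 + X1 + X2 - b = P * (e1 + e2 - e0)" "X0 + X1 + X3 - b = P * (e1 + e3 - e0)"
    "X0 + X2 + X3 - b = P * (e2 + e3 - e0)" "X0 + X1 + X2 + X3 - b = P * (e1 + e2 + e3 - 2 * e0)"
    using e by (simp_all add: right_diff_distrib distrib_left)
  then show ?L using \<open>?R\<close> by (metis dvd_triv_left)
qed blast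

text \<open>The letters are the values of one linear form at the points of the same name, and
  \<open>x - v - w\<close> is its value at \<open>z1\<close>. The assumption turns the sum of the
  three targets into the target at \<open>x\<close>.\<close>

lemma decomposition_linear_core:
  fixes P :: int
  assumes "P dvd b - (da + db + dc)"
  shows "P dvd v - da \<and> P dvd v + h1 - da \<and> P dvd w - db \<and> P dvd w + h2 - db
      \<and> P dvd x - v - w - dc \<and> P dvd x - v - w + h3 - dc
   \<longleftrightarrow> (P dvd x - b \<and> P dvd x + h1 - b \<and> P dvd x + h2 - b \<and> P dvd x + h3 - b) \<and> P dvd v - da \<and> P dvd w - db"
   (is "?L \<longleftrightarrow> ?R")
proof -
  obtain s where s: "b - (da + db + dc) = P * s" using assms by blast
  show ?thesis
  proof
    assume ?L
    then obtain e1 e2 e3 e4 e5 e6 where e: "v - da = P * e1" "v + h1 - da = P * e2"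
        "w - db = P * e3" "w + h2 - db = P * e4" "x - v - w - dc = P * e5" "x - v - w + h3 - dc = P * e6"
      unfolding dvd_def by blast
    have "x - b = P * (e5 + e1 + e3 - s)" "x + h1 - b = P * (e5 + e2 + e3 - s)"
      "x + h2 - b = P * (e5 + e1 + e4 - s)" "x + h3 - b = P * (e6 + e1 + e3 - s)"
      using e s by (simp_all add: right_diff_distrib distrib_left)
    then show ?R using \<open>?L\<close> by (metis dvd_triv_left)
  next
    assume ?R
    then obtain e0 e1 e2 e3 ev ew where e: "x - b = P * e0" "x + h1 - b = P * e1"
        "x + h2 - b = P * e2" "x + h3 - b = P * e3" "v - da = P * ev" "w - db = P * ew"
      unfolding dvd_def by blast
    have "v + h1 - da = P * (ev + e1 - e0)" "w + h2 - db = P * (ew + e2 - e0)"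
      "x - v - w - dc = P * (e0 - ev - ew + s)" "x - v - w + h3 - dc = P * (e3 - ev - ew + s)"
      using e s by (simp_all add: right_diff_distrib distrib_left)
    then show ?L using \<open>?R\<close> by (metis dvd_triv_left)
  qed
qed

text \<open>Here \<open>a\<close>, \<open>c\<close>, \<open>g\<close> are the values of one form at
  \<open>(v, v)\<close>, \<open>(w, w)\<close>, \<open>(v, w)\<close>, while \<open>A0\<close>,
  \<open>Ai\<close> and \<open>C0\<close>, \<open>Ci\<close> pair \<open>v\<close> and
  \<open>w\<close> with \<open>x\<close> and \<open>hi\<close>; \<open>X\<close> and
  \<open>H\<close> are as in \<open>parallelepiped_quadratic_core\<close>. Eighteen congruences
  become 7 + 5 + 5 + 1, which is why the main terms of the two norms agree.\<close>

lemma decomposition_quadratic_core: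
  fixes P :: int
  assumes two: "\<And>t. P dvd 2 * t \<Longrightarrow> P dvd t"
    and "P dvd b - (da + db + dc + 2 * dab + 2 * dac + 2 * dbc)"
  shows "P dvd a - da \<and> P dvd a + 2 * A1 + H11 - da \<and> P dvd c - db \<and> P dvd c + 2 * C2 + H22 - db
      \<and> P dvd X0 + a + c - 2 * A0 - 2 * C0 + 2 * g - dc
      \<and> P dvd X0 + a + c - 2 * A0 - 2 * C0 + 2 * g + 2 * X3 - 2 * A3 - 2 * C3 + H33 - dc
      \<and> P dvd g - dab \<and> P dvd g + C1 - dab \<and> P dvd g + A2 - dab \<and> P dvd g + A2 + C1 + H12 - dab
      \<and> P dvd A0 - a - g - dac \<and> P dvd A0 - a - g + X1 - A1 - C1 - dac
      \<and> P dvd A0 - a - g + A3 - dac \<and> P dvd A0 - a - g + X1 - A1 - C1 + A3 + H13 - dac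
      \<and> P dvd C0 - g - c - dbc \<and> P dvd C0 - g - c + X2 - A2 - C2 - dbc
      \<and> P dvd C0 - g - c + C3 - dbc \<and> P dvd C0 - g - c + X2 - A2 - C2 + C3 + H23 - dbc
   \<longleftrightarrow> (P dvd X0 - b \<and> P dvd X0 + 2 * X1 + H11 - b \<and> P dvd X0 + 2 * X2 + H22 - b
      \<and> P dvd H12 \<and> P dvd X0 + 2 * X3 + H33 - b \<and> P dvd H13 \<and> P dvd H23)
     \<and> (P dvd a - da \<and> P dvd A0 - (da + dab + dac) \<and> P dvd 2 * A1 + H11 \<and> P dvd A2 \<and> P dvd A3)
     \<and> (P dvd c - db \<and> P dvd C0 - (db + dab + dbc) \<and> P dvd 2 * C2 + H22 \<and> P dvd C1 \<and> P dvd C3)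
     \<and> P dvd g - dab" (is "?L \<longleftrightarrow> ?R")
proof -
  obtain s where s: "b - (da + db + dc + 2 * dab + 2 * dac + 2 * dbc) = P * s" using assms(2) by blast
  show ?thesis
  proof
    assume ?L
    then obtain e1 e2 e3 e4 e5 e6 e7 e8 e9 e10 e11 e12 e13 e14 e15 e16 e17 e18 where
      e: "a - da = P * e1" "a + 2 * A1 + H11 - da = P * e2" "c - db = P * e3" "c + 2 * C2 + H22 - db = P * e4"
      "X0 + a + c - 2 * A0 - 2 * C0 + 2 * g - dc = P * e5"
      "X0 + a + c - 2 * A0 - 2 * C0 + 2 * g + 2 * X3 - 2 * A3 - 2 * C3 + H33 - dc = P * e6"
      "g - dab = P * e7" "g + C1 - dab = P * e8" "g + A2 - dab = P * e9" "g + A2 + C1 + H12 - dab = P * e10"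
      "A0 - a - g - dac = P * e11" "A0 - a - g + X1 - A1 - C1 - dac = P * e12"
      "A0 - a - g + A3 - dac = P * e13" "A0 - a - g + X1 - A1 - C1 + A3 + H13 - dac = P * e14"
      "C0 - g - c - dbc = P * e15" "C0 - g - c + X2 - A2 - C2 - dbc = P * e16"
      "C0 - g - c + C3 - dbc = P * e17" "C0 - g - c + X2 - A2 - C2 + C3 + H23 - dbc = P * e18"
      by (elim conjE dvdE) blast
    have A: "2 * A1 + H11 = P * (e2 - e1)" "2 * C2 + H22 = P * (e4 - e3)"
      "C1 = P * (e8 - e7)" "A2 = P * (e9 - e7)" "H12 = P * (e10 - e9 - e8 + e7)"
      "A3 = P * (e13 - e11)" "C3 = P * (e17 - e15)"
      "H13 = P * (e14 - e13 - e12 + e11)" "H23 = P * (e18 - e17 - e16 + e15)"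
      "A0 - (da + dab + dac) = P * (e11 + e1 + e7)" "C0 - (db + dab + dbc) = P * (e15 + e3 + e7)"
      "X0 - b = P * (e5 + e1 + e3 + 2 * e7 + 2 * e11 + 2 * e15 - s)"
      using e s by (simp_all add: right_diff_distrib distrib_left)
    have B: "X1 - A1 = P * (e12 - e11 + e8 - e7)" "X2 - C2 = P * (e16 - e15 + e9 - e7)"
      "2 * X3 + H33 = P * (e6 - e5 + 2 * (e13 - e11) + 2 * (e17 - e15))"
      using e A by (simp_all add: right_diff_distrib distrib_left)
    let ?x0 = "e5 + e1 + e3 + 2 * e7 + 2 * e11 + 2 * e15 - s"
    have "X0 + 2 * X1 + H11 - b = P * (?x0 + 2 * (e12 - e11 + e8 - e7) + (e2 - e1))"
      "X0 + 2 * X2 + H22 - b = P * (?x0 + 2 * (e16 - e15 + e9 - e7) + (e4 - e3))"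
      "X0 + 2 * X3 + H33 - b = P * (?x0 + (e6 - e5 + 2 * (e13 - e11) + 2 * (e17 - e15)))"
      using A B by (simp_all only: distrib_left mult.left_commute[of P 2])
    with A e(1,3,7) show ?R by (simp only: dvd_triv_left simp_thms)
  next
    assume ?R
    then obtain e1 e2 e3 e4 e5 e6 e7 e8 e9 e10 e11 e12 e13 e14 e15 e16 e17 e18 where
      e: "X0 - b = P * e1" "X0 + 2 * X1 + H11 - b = P * e2" "X0 + 2 * X2 + H22 - b = P * e3"
      "H12 = P * e4" "X0 + 2 * X3 + H33 - b = P * e5" "H13 = P * e6" "H23 = P * e7"
      "a - da = P * e8" "A0 - (da + dab + dac) = P * e9" "2 * A1 + H11 = P * e10" "A2 = P * e11" "A3 = P * e12"
      "c - db = P * e13" "C0 - (db + dab + dbc) = P * e14" "2 * C2 + H22 = P * e15" "C1 = P * e16" "C3 = P * e17"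
      "g - dab = P * e18"
      by (elim conjE dvdE) blast
    \<comment> \<open>Only the doubles of \<open>X1 - A1\<close> and \<open>X2 - C2\<close> can be
      read off from the right-hand side; \<open>two\<close> halves them.\<close>
    have "2 * (X1 - A1) = P * (e2 - e1 - e10)" "2 * (X2 - C2) = P * (e3 - e1 - e15)"
      using e by (simp_all add: right_diff_distrib distrib_left)
    then obtain f1 f2 where f: "X1 - A1 = P * f1" "X2 - C2 = P * f2"
      using two by (metis dvd_triv_left dvdE)
    have "a + 2 * A1 + H11 - da = P * (e8 + e10)" "c + 2 * C2 + H22 - db = P * (e13 + e15)"
      "X0 + a + c - 2 * A0 - 2 * C0 + 2 * g - dc = P * (e1 + e8 + e13 - 2 * e9 - 2 * e14 + 2 * e18 + s)"
      "X0 + a + c - 2 * A0 - 2 * C0 + 2 * g + 2 * X3 - 2 * A3 - 2 * C3 + H33 - dc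
        = P * (e5 + e8 + e13 - 2 * e9 - 2 * e14 + 2 * e18 + s - 2 * e12 - 2 * e17)"
      "g + C1 - dab = P * (e18 + e16)" "g + A2 - dab = P * (e18 + e11)"
      "g + A2 + C1 + H12 - dab = P * (e18 + e11 + e16 + e4)"
      using e s by (simp_all add: right_diff_distrib distrib_left)
    moreover have "A0 - a - g - dac = P * (e9 - e8 - e18)" "A0 - a - g + X1 - A1 - C1 - dac = P * (e9 - e8 - e18 + f1 - e16)"
      "A0 - a - g + A3 - dac = P * (e9 - e8 - e18 + e12)"
      "A0 - a - g + X1 - A1 - C1 + A3 + H13 - dac = P * (e9 - e8 - e18 + f1 - e16 + e12 + e6)"
      using e f by (simp_all add: right_diff_distrib distrib_left)
    moreover have "C0 - g - c - dbc = P * (e14 - e18 - e13)" "C0 - g - c + X2 - A2 - C2 - dbc = P * (e14 - e18 - e13 + f2 - e11)"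
      "C0 - g - c + C3 - dbc = P * (e14 - e18 - e13 + e17)"
      "C0 - g - c + X2 - A2 - C2 + C3 + H23 - dbc = P * (e14 - e18 - e13 + f2 - e11 + e17 + e7)"
      using e f by (simp_all add: right_diff_distrib distrib_left)
    ultimately show ?L using e(8,13,18) by (simp only: dvd_triv_left simp_thms)
  qed
qed

text \<open>The \<open>gi\<close> and \<open>ai\<close> are normalised sizes of level sets and
  atoms, and \<open>u\<close> that of the set of parallelepipeds. The 18 factors of \<open>k\<close>
  give \<open>1 - 18 * \<tau> \<le> k \<le> 1 + 36 * \<tau>\<close>, so \<open>u\<close> and
  \<open>k\<close> differ by at most \<open>37 * \<tau>\<close>; dividing
  \<open>\<tau> + 37 * \<tau>\<close> by \<open>k \<ge> 1 / 2\<close> yields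
  \<open>76 * \<tau>\<close>, rounded up to 80.\<close>

lemma normalized_difference_bound:
  fixes \<tau> :: real
  assumes \<tau>: "0 \<le> \<tau>" "36 * \<tau> \<le> 1"
    and g: "\<bar>g1 - 1\<bar> \<le> \<tau>" "\<bar>g2 - 1\<bar> \<le> \<tau>" "\<bar>g3 - 1\<bar> \<le> \<tau>"
    and a: "\<bar>a1 - 1\<bar> \<le> \<tau>" "\<bar>a2 - 1\<bar> \<le> \<tau>" "\<bar>a3 - 1\<bar> \<le> \<tau>"
    and u: "\<bar>u - 1\<bar> \<le> \<tau>" and T: "\<bar>T\<bar> \<le> u" and R: "\<bar>R - T\<bar> \<le> \<tau>"
  shows "\<bar>R / (g1 ^ 4 * g2 ^ 4 * g3 ^ 4 * a1 ^ 2 * a2 ^ 2 * a3 ^ 2) - T / u\<bar> \<le> 80 * \<tau>"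
proof -
  define k where "k = g1 ^ 4 * g2 ^ 4 * g3 ^ 4 * a1 ^ 2 * a2 ^ 2 * a3 ^ 2"
  have lo: "(1 - \<tau>) ^ m \<le> y ^ m" and hi: "y ^ m \<le> (1 + \<tau>) ^ m" and pos: "0 \<le> y ^ m"
    if "\<bar>y - 1\<bar> \<le> \<tau>" for y m
    using that \<tau> by (auto intro!: power_mono)
  have "(1 - \<tau>) ^ 18 = (1 - \<tau>) ^ 4 * (1 - \<tau>) ^ 4 * (1 - \<tau>) ^ 4 * (1 - \<tau>) ^ 2 * (1 - \<tau>) ^ 2 * (1 - \<tau>) ^ 2"
    by (simp flip: power_add)
  also have "\<dots> \<le> k"
    unfolding k_def using \<tau> by (intro mult_mono lo g a mult_nonneg_nonneg pos zero_le_power) auto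
  finally have k1: "(1 - \<tau>) ^ 18 \<le> k" .
  have "k \<le> (1 + \<tau>) ^ 4 * (1 + \<tau>) ^ 4 * (1 + \<tau>) ^ 4 * (1 + \<tau>) ^ 2 * (1 + \<tau>) ^ 2 * (1 + \<tau>) ^ 2"
    unfolding k_def using \<tau> by (intro mult_mono hi g a mult_nonneg_nonneg pos zero_le_power) auto
  also have "\<dots> = (1 + \<tau>) ^ 18" by (simp flip: power_add)
  finally have k2: "k \<le> (1 + \<tau>) ^ 18" .
  have B: "1 - 18 * \<tau> \<le> (1 - \<tau>) ^ 18"
    using Bernoulli_inequality[of "- \<tau>" 18] \<tau> by simp
  \<comment> \<open>Bernoulli's inequality bounds powers from below only; this product turns it into
    an upper bound for \<open>k\<close>.\<close>
  have "(1 + \<tau>) ^ 18 * (1 - \<tau>) ^ 18 = (1 - \<tau> ^ 2) ^ 18"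
    unfolding power_mult_distrib[symmetric] by (simp add: algebra_simps power2_eq_square)
  also have "\<dots> \<le> 1" using \<tau> by (intro power_le_one) (auto simp: power_le_one)
  finally have B2: "(1 + \<tau>) ^ 18 * (1 - \<tau>) ^ 18 \<le> 1" .
  have "k * (1 - 18 * \<tau>) \<le> (1 + \<tau>) ^ 18 * (1 - 18 * \<tau>)"
    using k2 \<tau> by (intro mult_right_mono) auto
  also have "\<dots> \<le> (1 + \<tau>) ^ 18 * (1 - \<tau>) ^ 18"
    using B \<tau> by (intro mult_left_mono) auto
  also note B2
  also have "1 \<le> (1 + 36 * \<tau>) * (1 - 18 * \<tau>)"
  proof -
    have "0 \<le> 18 * \<tau> * (1 - 36 * \<tau>)" using \<tau> by simp
    then show ?thesis by (simp add: algebra_simps)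
  qed
  finally have "k \<le> 1 + 36 * \<tau>" using \<tau> by (simp add: mult_le_cancel_right)
  moreover have kh: "1 / 2 \<le> k" "1 - 18 * \<tau> \<le> k" using k1 B \<tau> by linarith+
  ultimately have uk: "\<bar>u - k\<bar> \<le> 37 * \<tau>" using u \<tau> by linarith
  have upos: "0 < u" using u \<tau> by linarith
  have "R / k - T / u = (R - T) / k + (T / u) * ((u - k) / k)"
    using upos kh by (simp add: field_simps)
  also have "\<bar>\<dots>\<bar> \<le> \<bar>R - T\<bar> / k + \<bar>T / u\<bar> * (\<bar>u - k\<bar> / k)"
    using kh by (intro order_trans[OF abs_triangle_ineq]) (simp add: abs_mult)
  also have "\<dots> \<le> \<tau> / k + 1 * (37 * \<tau> / k)"
    using kh R uk T upos by (intro add_mono mult_mono divide_right_mono) auto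
  also have "\<dots> = 38 * \<tau> / k" by (simp add: field_simps)
  also have "\<dots> \<le> 38 * \<tau> / (1 / 2)"
    using kh \<tau> by (intro divide_left_mono) auto
  also have "\<dots> \<le> 80 * \<tau>" using \<tau> by simp
  finally show ?thesis unfolding k_def .
qed

lemma abs_cube_prod_le_1:
  assumes "p > 0" "\<forall>x\<in>Vn p n. \<bar>f x\<bar> \<le> 1"
  shows "\<bar>cube_prod p n f x h1 h2 h3\<bar> \<le> 1"
proof -
  have "\<bar>f (red p n w)\<bar> \<le> 1" for w using assms red_in by blast
  then show ?thesis unfolding cube_prod_def abs_mult by (intro mult_le_one) (auto intro: mult_nonneg_nonneg)
qed

context quadratic_factor
begin

section \<open>Vertex and octahedral conditions in the new variables\<close>

lemma two_dvd: "int p dvd 2 * t \<Longrightarrow> int p dvd t"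
  using odd_p by (simp add: coprime_dvd_mult_right_iff)

lemma parallelepiped_iff_vertices:
  "inB b x \<and> inB b (x + h1) \<and> inB b (x + h2) \<and> inB b (x + (h1 + h2)) \<and> inB b (x + h3)
     \<and> inB b (x + (h1 + h3)) \<and> inB b (x + (h2 + h3)) \<and> inB b (x + (h1 + h2 + h3)) \<longleftrightarrow> parallelepiped b x h1 h2 h3"
proof -
  let ?D = "\<lambda>k u. int p dvd dot n u (rs!k) - fst b k"
  let ?B = "\<lambda>k u. int p dvd bil n (Ms!k) u u - snd b k"
  let ?Z = "\<lambda>k u v. int p dvd bil n (Ms!k) u v"
  let ?L1 = "\<lambda>k. ?D k x \<and> ?D k (x + h1) \<and> ?D k (x + h2) \<and> ?D k (x + (h1 + h2)) \<and> ?D k (x + h3)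
     \<and> ?D k (x + (h1 + h3)) \<and> ?D k (x + (h2 + h3)) \<and> ?D k (x + (h1 + h2 + h3))"
  let ?L2 = "\<lambda>k. ?D k x \<and> ?D k (h1 + x) \<and> ?D k (h2 + x) \<and> ?D k (h3 + x)"
  have L: "?L1 k \<longleftrightarrow> ?L2 k" for k
    using parallelepiped_linear_core[of "int p" "dot n x (rs!k)" "fst b k" "dot n h1 (rs!k)" "dot n h2 (rs!k)" "dot n h3 (rs!k)"]
    by (simp add: dot_simps add_ac)
  let ?Q1 = "\<lambda>k. ?B k x \<and> ?B k (x + h1) \<and> ?B k (x + h2) \<and> ?B k (x + (h1 + h2)) \<and> ?B k (x + h3)
     \<and> ?B k (x + (h1 + h3)) \<and> ?B k (x + (h2 + h3)) \<and> ?B k (x + (h1 + h2 + h3))"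
  let ?Q2 = "\<lambda>k. ?B k x \<and> ?B k (h1 + x) \<and> ?B k (h2 + x) \<and> ?Z k h2 h1 \<and> ?B k (h3 + x) \<and> ?Z k h3 h1 \<and> ?Z k h3 h2"
  have Q: "?Q1 k \<longleftrightarrow> ?Q2 k" if k: "k < q" for k
  proof -
    let ?b = "bil n (Ms!k)"
    note comm = bil_commute[OF symm_Ms[OF k]]
    note cs = comm[of h1 x] comm[of h2 x] comm[of h3 x] comm[of h2 h1] comm[of h3 h1] comm[of h3 h2]
    have e: "?b (x + h1) (x + h1) = ?b x x + 2 * ?b x h1 + ?b h1 h1"
      "?b (x + h2) (x + h2) = ?b x x + 2 * ?b x h2 + ?b h2 h2"
      "?b (x + h3) (x + h3) = ?b x x + 2 * ?b x h3 + ?b h3 h3"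
      "?b (x + (h1 + h2)) (x + (h1 + h2)) = ?b x x + 2 * ?b x h1 + 2 * ?b x h2 + ?b h1 h1 + ?b h2 h2 + 2 * ?b h1 h2"
      "?b (x + (h1 + h3)) (x + (h1 + h3)) = ?b x x + 2 * ?b x h1 + 2 * ?b x h3 + ?b h1 h1 + ?b h3 h3 + 2 * ?b h1 h3"
      "?b (x + (h2 + h3)) (x + (h2 + h3)) = ?b x x + 2 * ?b x h2 + 2 * ?b x h3 + ?b h2 h2 + ?b h3 h3 + 2 * ?b h2 h3"
      "?b (x + (h1 + h2 + h3)) (x + (h1 + h2 + h3)) = ?b x x + 2 * ?b x h1 + 2 * ?b x h2 + 2 * ?b x h3
         + ?b h1 h1 + ?b h2 h2 + ?b h3 h3 + 2 * ?b h1 h2 + 2 * ?b h1 h3 + 2 * ?b h2 h3"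
      by (simp_all add: bil_simps cs)
    show ?thesis
      unfolding add.commute[of h1 x] add.commute[of h2 x] add.commute[of h3 x] e
        comm[of h2 h1] comm[of h3 h1] comm[of h3 h2]
      by (rule parallelepiped_quadratic_core[OF two_dvd])
  qed
  have "inB b x \<and> inB b (x + h1) \<and> inB b (x + h2) \<and> inB b (x + (h1 + h2)) \<and> inB b (x + h3)
     \<and> inB b (x + (h1 + h3)) \<and> inB b (x + (h2 + h3)) \<and> inB b (x + (h1 + h2 + h3)) \<longleftrightarrow> (\<forall>k<l. ?L1 k) \<and> (\<forall>k<q. ?Q1 k)"
    unfolding inB_def inQ_def by (simp only: imp_conjR all_conj_distrib conj_ac)
  also have "\<dots> \<longleftrightarrow> (\<forall>k<l. ?L2 k) \<and> (\<forall>k<q. ?Q2 k)"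
    by (intro arg_cong2[of _ _ _ _ "(\<and>)"] all_cong L Q)
  also have "\<dots> \<longleftrightarrow> parallelepiped b x h1 h2 h3"
    unfolding parallelepiped_def inB_def inQ_def diff_0_right by (simp only: imp_conjR all_conj_distrib conj_ac)
  finally show ?thesis .
qed

text \<open>The support of the Terry-Wolf weight. The twelve \<open>inQ\<close> conditions are the
  edges of an octahedron, the complete tripartite graph with parts \<open>{x1, x2}\<close>,
  \<open>{y1, y2}\<close>, \<open>{z1, z2}\<close>.\<close>

definition octahedral where
  "octahedral da db dc dab dac dbc x1 x2 y1 y2 z1 z2 \<longleftrightarrow>
     inB da x1 \<and> inB da x2 \<and> inB db y1 \<and> inB db y2 \<and> inB dc z1 \<and> inB dc z2
     \<and> inQ dab x1 y1 \<and> inQ dab x2 y1 \<and> inQ dab x1 y2 \<and> inQ dab x2 y2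
     \<and> inQ dac x1 z1 \<and> inQ dac x2 z1 \<and> inQ dac x1 z2 \<and> inQ dac x2 z2
     \<and> inQ dbc y1 z1 \<and> inQ dbc y2 z1 \<and> inQ dbc y1 z2 \<and> inQ dbc y2 z2"

text \<open>For each \<open>k\<close> separately both sides are systems of congruences between
  values of one form, so after expansion the two decomposition cores apply. The equation
  \<open>\<Sigma>(d) = b\<close> enters as the two assumed congruences.\<close>

lemma octahedral_iff:
  assumes fst_b: "\<And>k. int p dvd fst b k - (fst da k + fst db k + fst dc k)"
    and snd_b: "\<And>k. int p dvd snd b k - (snd da k + snd db k + snd dc k + 2 * dab k + 2 * dac k + 2 * dbc k)"
  shows "octahedral da db dc dab dac dbc v (h1 + v) w (h2 + w) (x - (v + w)) (h3 + (x - (v + w)))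
    \<longleftrightarrow> parallelepiped b x h1 h2 h3 \<and> base_point da (\<lambda>k. snd da k + dab k + dac k) x h1 h2 h3 v
       \<and> (base_point db (\<lambda>k. snd db k + dab k + dbc k) x h2 h1 h3 w \<and> inQ dab w v)"
proof -
  let ?D = "\<lambda>k d u. int p dvd dot n u (rs!k) - fst d k"
  let ?B = "\<lambda>k c u v. int p dvd bil n (Ms!k) u v - c k"
  let ?Z = "\<lambda>k u v. int p dvd bil n (Ms!k) u v"
  let ?z = "x - (v + w)"
  let ?L1 = "\<lambda>k. ?D k da v \<and> ?D k da (h1 + v) \<and> ?D k db w \<and> ?D k db (h2 + w) \<and> ?D k dc ?z \<and> ?D k dc (h3 + ?z)"
  let ?L2 = "\<lambda>k. (?D k b x \<and> ?D k b (h1 + x) \<and> ?D k b (h2 + x) \<and> ?D k b (h3 + x)) \<and> ?D k da v \<and> ?D k db w"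
  have L: "?L1 k \<longleftrightarrow> ?L2 k" for k
    using decomposition_linear_core[OF fst_b[of k], of "dot n v (rs!k)" "dot n h1 (rs!k)" "dot n w (rs!k)" "dot n h2 (rs!k)"
        "dot n x (rs!k)" "dot n h3 (rs!k)"]
    by (simp add: dot_simps algebra_simps)
  let ?Q1 = "\<lambda>k. ?B k (snd da) v v \<and> ?B k (snd da) (h1 + v) (h1 + v) \<and> ?B k (snd db) w w \<and> ?B k (snd db) (h2 + w) (h2 + w)
     \<and> ?B k (snd dc) ?z ?z \<and> ?B k (snd dc) (h3 + ?z) (h3 + ?z)
     \<and> ?B k dab v w \<and> ?B k dab (h1 + v) w \<and> ?B k dab v (h2 + w) \<and> ?B k dab (h1 + v) (h2 + w)
     \<and> ?B k dac v ?z \<and> ?B k dac (h1 + v) ?z \<and> ?B k dac v (h3 + ?z) \<and> ?B k dac (h1 + v) (h3 + ?z)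
     \<and> ?B k dbc w ?z \<and> ?B k dbc (h2 + w) ?z \<and> ?B k dbc w (h3 + ?z) \<and> ?B k dbc (h2 + w) (h3 + ?z)"
  let ?Q2 = "\<lambda>k. (?B k (snd b) x x \<and> ?B k (snd b) (h1 + x) (h1 + x) \<and> ?B k (snd b) (h2 + x) (h2 + x) \<and> ?Z k h2 h1
       \<and> ?B k (snd b) (h3 + x) (h3 + x) \<and> ?Z k h3 h1 \<and> ?Z k h3 h2)
     \<and> (?B k (snd da) v v \<and> int p dvd bil n (Ms!k) v x - (snd da k + dab k + dac k)
        \<and> int p dvd bil n (Ms!k) v h1 - (- (half * bil n (Ms!k) h1 h1)) \<and> ?Z k v h2 \<and> ?Z k v h3)
     \<and> (?B k (snd db) w w \<and> int p dvd bil n (Ms!k) w x - (snd db k + dab k + dbc k)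
        \<and> int p dvd bil n (Ms!k) w h2 - (- (half * bil n (Ms!k) h2 h2)) \<and> ?Z k w h1 \<and> ?Z k w h3)
     \<and> ?B k dab w v"
  have Q: "?Q1 k \<longleftrightarrow> ?Q2 k" if k: "k < q" for k
  proof -
    let ?b = "bil n (Ms!k)"
    note comm = bil_commute[OF symm_Ms[OF k]]
    note cs = comm[of h1 x] comm[of h2 x] comm[of h3 x] comm[of h2 h1] comm[of h3 h1] comm[of h3 h2]
      comm[of h1 v] comm[of h2 v] comm[of h3 v] comm[of x v] comm[of h1 w] comm[of h2 w] comm[of h3 w] comm[of x w] comm[of w v]
    have e: "?b (h1 + x) (h1 + x) = ?b x x + 2 * ?b x h1 + ?b h1 h1"
      "?b (h2 + x) (h2 + x) = ?b x x + 2 * ?b x h2 + ?b h2 h2"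
      "?b (h3 + x) (h3 + x) = ?b x x + 2 * ?b x h3 + ?b h3 h3"
      "?b (h1 + v) (h1 + v) = ?b v v + 2 * ?b v h1 + ?b h1 h1"
      "?b (h2 + w) (h2 + w) = ?b w w + 2 * ?b w h2 + ?b h2 h2"
      "?b ?z ?z = ?b x x + ?b v v + ?b w w - 2 * ?b v x - 2 * ?b w x + 2 * ?b v w"
      "?b (h3 + ?z) (h3 + ?z) = ?b x x + ?b v v + ?b w w - 2 * ?b v x - 2 * ?b w x + 2 * ?b v w
         + 2 * ?b x h3 - 2 * ?b v h3 - 2 * ?b w h3 + ?b h3 h3"
      "?b (h1 + v) w = ?b v w + ?b w h1" "?b v (h2 + w) = ?b v w + ?b v h2"
      "?b (h1 + v) (h2 + w) = ?b v w + ?b v h2 + ?b w h1 + ?b h1 h2"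
      "?b v ?z = ?b v x - ?b v v - ?b v w"
      "?b (h1 + v) ?z = ?b v x - ?b v v - ?b v w + ?b x h1 - ?b v h1 - ?b w h1"
      "?b v (h3 + ?z) = ?b v x - ?b v v - ?b v w + ?b v h3"
      "?b (h1 + v) (h3 + ?z) = ?b v x - ?b v v - ?b v w + ?b x h1 - ?b v h1 - ?b w h1 + ?b v h3 + ?b h1 h3"
      "?b w ?z = ?b w x - ?b v w - ?b w w"
      "?b (h2 + w) ?z = ?b w x - ?b v w - ?b w w + ?b x h2 - ?b v h2 - ?b w h2"
      "?b w (h3 + ?z) = ?b w x - ?b v w - ?b w w + ?b w h3"
      "?b (h2 + w) (h3 + ?z) = ?b w x - ?b v w - ?b w w + ?b x h2 - ?b v h2 - ?b w h2 + ?b w h3 + ?b h2 h3"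
      by (simp_all add: bil_simps cs)
    show ?thesis
      unfolding e half_dvd comm[of h2 h1] comm[of h3 h1] comm[of h3 h2] comm[of w v]
      by (rule decomposition_quadratic_core[OF two_dvd snd_b[of k]])
  qed
  have "octahedral da db dc dab dac dbc v (h1 + v) w (h2 + w) ?z (h3 + ?z) \<longleftrightarrow> (\<forall>k<l. ?L1 k) \<and> (\<forall>k<q. ?Q1 k)"
    unfolding octahedral_def inB_def inQ_def by (simp only: imp_conjR all_conj_distrib conj_ac)
  also have "\<dots> \<longleftrightarrow> (\<forall>k<l. ?L2 k) \<and> (\<forall>k<q. ?Q2 k)"
    by (intro arg_cong2[of _ _ _ _ "(\<and>)"] all_cong L Q)
  also have "\<dots> \<longleftrightarrow> parallelepiped b x h1 h2 h3 \<and> base_point da (\<lambda>k. snd da k + dab k + dac k) x h1 h2 h3 v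
       \<and> (base_point db (\<lambda>k. snd db k + dab k + dbc k) x h2 h1 h3 w \<and> inQ dab w v)"
    unfolding parallelepiped_def base_point_def inB_def inQ_def diff_0_right by (simp only: imp_conjR all_conj_distrib conj_ac)
  finally show ?thesis .
qed


section \<open>The Prendiville norm as a sum over parallelepipeds\<close>

lemma cube_prod_indicator:
  assumes "b \<in> Vn p l \<times> Vn p q"
  shows "cube_prod p n (\<lambda>x. f x * indicator (atom p n rs Ms b) x) x h1 h2 h3
    = of_bool (parallelepiped b x h1 h2 h3) * cube_prod p n f x h1 h2 h3"
proof -
  have ind: "indicator (atom p n rs Ms b) (red p n w) = (of_bool (inB b w) :: real)" for w
    by (simp add: indicator_def atom_iff[OF assms] red_in[OF p_pos] inB_red)
  show ?thesis
    unfolding cube_prod_def ind parallelepiped_iff_vertices[symmetric] of_bool_conj by (simp only: mult_ac)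
qed

lemma u3_sum_local:
  assumes "b \<in> Vn p l \<times> Vn p q"
  shows "u3_sum p n (\<lambda>x. f x * indicator (atom p n rs Ms b) x)
    = (\<Sum>x\<in>V. \<Sum>h1\<in>V. \<Sum>h2\<in>V. \<Sum>h3\<in>V. of_bool (parallelepiped b x h1 h2 h3) * cube_prod p n f x h1 h2 h3)"
  by (simp only: u3_sum_eq[OF p_pos] cube_prod_indicator[OF assms])

lemma u3_sum_atom:
  assumes "b \<in> Vn p l \<times> Vn p q"
  shows "u3_sum p n (indicator (atom p n rs Ms b))
    = (\<Sum>x\<in>V. \<Sum>h1\<in>V. \<Sum>h2\<in>V. \<Sum>h3\<in>V. of_bool (parallelepiped b x h1 h2 h3))"
proof -
  have "cube_prod p n (\<lambda>_. 1) x h1 h2 h3 = 1" for x h1 h2 h3 by (simp add: cube_prod_def)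
  then show ?thesis using u3_sum_local[OF assms, of "\<lambda>_. 1"] by (simp only: mult_1 mult_1_right)
qed

text \<open>When the numerator vanishes, the default value 0 in \<open>prend_norm\<close> agrees
  with the quotient.\<close>

lemma prend_norm_pow8:
  assumes "u3_sum p n (indicator (atom p n rs Ms b)) > 0"
  shows "prend_norm p n rs Ms f b ^ 8
    = u3_sum p n (\<lambda>x. f x * indicator (atom p n rs Ms b) x) / u3_sum p n (indicator (atom p n rs Ms b))"
proof -
  have r: "root 8 y ^ 8 = y" if "y \<ge> 0" for y using that by (simp add: real_root_pow_pos2)
  show ?thesis
    using r[OF u3_sum_nonneg[OF p_pos, of n "\<lambda>x. f x * indicator (atom p n rs Ms b) x"]] r[of "u3_sum p n (indicator (atom p n rs Ms b))"] assms
    by (auto simp: prend_norm_def Let_def u3_norm_def power_divide)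
qed

section \<open>The Terry-Wolf norm in the new variables\<close>

lemma mu_eq:
  assumes "u \<in> Vn p q" "x \<in> V" "y \<in> V"
  shows "mu p n (qpre p n Ms u) x y = N ^ 2 / real (card (qpre p n Ms u)) * of_bool (inQ u x y)"
  using assms by (simp add: mu_def qpre_iff indicator_def card_V)

text \<open>Each substitution translates one variable by variables fixed in the outer sums;
  \<open>z1\<close> comes last since its shift \<open>v + w\<close> involves both base points.
  Afterwards the six sums are only reordered.\<close>

lemma sum_reparametrize:
  fixes G :: "(nat \<Rightarrow> int) \<Rightarrow> (nat \<Rightarrow> int) \<Rightarrow> (nat \<Rightarrow> int) \<Rightarrow> (nat \<Rightarrow> int) \<Rightarrow> (nat \<Rightarrow> int) \<Rightarrow> (nat \<Rightarrow> int) \<Rightarrow> real"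
  shows "(\<Sum>x1\<in>V. \<Sum>x2\<in>V. \<Sum>y1\<in>V. \<Sum>y2\<in>V. \<Sum>z1\<in>V. \<Sum>z2\<in>V. G x1 x2 y1 y2 z1 z2)
   = (\<Sum>x\<in>V. \<Sum>h1\<in>V. \<Sum>h2\<in>V. \<Sum>h3\<in>V. \<Sum>v\<in>V. \<Sum>w\<in>V.
       G v (red p n (h1 + v)) w (red p n (h2 + w)) (red p n (x - (v + w))) (red p n (h3 + (x - (v + w)))))"
proof -
  let ?r = "red p n"
  let ?G = "\<lambda>v h1 w h2 x h3. G v (?r (h1 + v)) w (?r (h2 + w)) (?r (x - (v + w))) (?r (h3 + (x - (v + w))))"
  have z: "(\<Sum>z1\<in>V. \<Sum>z2\<in>V. F z1 z2) = (\<Sum>x\<in>V. \<Sum>h3\<in>V. F (?r (x - u)) (?r (h3 + (x - u))))"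
    for F :: "(nat \<Rightarrow> int) \<Rightarrow> (nat \<Rightarrow> int) \<Rightarrow> real" and u
  proof -
    have "(\<Sum>z1\<in>V. \<Sum>z2\<in>V. F z1 z2) = (\<Sum>x\<in>V. \<Sum>z2\<in>V. F (?r (x - u)) z2)"
      by (rule sum_Vn_shift_minus[OF p_pos, symmetric])
    also have "\<dots> = (\<Sum>x\<in>V. \<Sum>h3\<in>V. F (?r (x - u)) (?r (h3 + (x - u))))"
      by (rule sum.cong[OF refl], rule sum_Vn_shift[OF p_pos, symmetric])
    finally show ?thesis .
  qed
  have "(\<Sum>x1\<in>V. \<Sum>x2\<in>V. \<Sum>y1\<in>V. \<Sum>y2\<in>V. \<Sum>z1\<in>V. \<Sum>z2\<in>V. G x1 x2 y1 y2 z1 z2)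
    = (\<Sum>v\<in>V. \<Sum>h1\<in>V. \<Sum>y1\<in>V. \<Sum>y2\<in>V. \<Sum>z1\<in>V. \<Sum>z2\<in>V. G v (?r (h1 + v)) y1 y2 z1 z2)"
    by (rule sum.cong[OF refl], rule sum_Vn_shift[OF p_pos, symmetric])
  also have "\<dots> = (\<Sum>v\<in>V. \<Sum>h1\<in>V. \<Sum>w\<in>V. \<Sum>h2\<in>V. \<Sum>z1\<in>V. \<Sum>z2\<in>V. G v (?r (h1 + v)) w (?r (h2 + w)) z1 z2)"
    by (rule sum.cong[OF refl], rule sum.cong[OF refl], rule sum.cong[OF refl], rule sum_Vn_shift[OF p_pos, symmetric])
  also have "\<dots> = (\<Sum>v\<in>V. \<Sum>h1\<in>V. \<Sum>w\<in>V. \<Sum>h2\<in>V. \<Sum>x\<in>V. \<Sum>h3\<in>V. ?G v h1 w h2 x h3)"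
    by (rule sum.cong[OF refl], rule sum.cong[OF refl], rule sum.cong[OF refl], rule sum.cong[OF refl], rule z)
  also have "\<dots> = (\<Sum>(v, h1, w, h2, x, h3)\<in>V \<times> V \<times> V \<times> V \<times> V \<times> V. ?G v h1 w h2 x h3)"
    by (simp only: sum.cartesian_product)
  also have "\<dots> = (\<Sum>(x, h1, h2, h3, v, w)\<in>V \<times> V \<times> V \<times> V \<times> V \<times> V. ?G v h1 w h2 x h3)"
    by (rule sum.reindex_bij_witness[where i = "\<lambda>(x, h1, h2, h3, v, w). (v, h1, w, h2, x, h3)"
          and j = "\<lambda>(v, h1, w, h2, x, h3). (x, h1, h2, h3, v, w)"]) auto
  also have "\<dots> = (\<Sum>x\<in>V. \<Sum>h1\<in>V. \<Sum>h2\<in>V. \<Sum>h3\<in>V. \<Sum>v\<in>V. \<Sum>w\<in>V. ?G v h1 w h2 x h3)"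
    by (simp only: sum.cartesian_product)
  finally show ?thesis .
qed

definition sum_prod :: "((nat \<Rightarrow> int) \<Rightarrow> real) \<Rightarrow> (nat \<Rightarrow> int) \<Rightarrow> (nat \<Rightarrow> int) \<Rightarrow> (nat \<Rightarrow> int) \<Rightarrow> (nat \<Rightarrow> int) \<Rightarrow> (nat \<Rightarrow> int) \<Rightarrow> (nat \<Rightarrow> int) \<Rightarrow> real" where
  "sum_prod f x1 x2 y1 y2 z1 z2 =
     f (vadd p (vadd p x1 y1) z1) * f (vadd p (vadd p x2 y1) z1) * f (vadd p (vadd p x1 y2) z1) * f (vadd p (vadd p x2 y2) z1)
     * f (vadd p (vadd p x1 y1) z2) * f (vadd p (vadd p x2 y1) z2) * f (vadd p (vadd p x1 y2) z2) * f (vadd p (vadd p x2 y2) z2)"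

lemma sum_prod_eq_cube_prod:
  assumes "v \<in> V" "w \<in> V"
  shows "sum_prod f v (red p n (h1 + v)) w (red p n (h2 + w)) (red p n (x - (v + w))) (red p n (h3 + (x - (v + w))))
    = cube_prod p n f x h1 h2 h3"
proof -
  have v: "v = red p n v" "w = red p n w" using assms by (simp_all add: red_Vn)
  have "sum_prod f (red p n v) (red p n (h1 + v)) (red p n w) (red p n (h2 + w)) (red p n (x - (v + w))) (red p n (h3 + (x - (v + w))))
    = cube_prod p n f x h1 h2 h3"
    unfolding sum_prod_def cube_prod_def vadd_red
    by (simp add: algebra_simps)
  then show ?thesis using v by simp
qed

lemma tw_norm8_eq:
  assumes d: "da \<in> Vn p l \<times> Vn p q" "db \<in> Vn p l \<times> Vn p q" "dc \<in> Vn p l \<times> Vn p q"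
    and e: "dab \<in> Vn p q" "dac \<in> Vn p q" "dbc \<in> Vn p q"
    and fst_b: "\<And>k. int p dvd fst b k - (fst da k + fst db k + fst dc k)"
    and snd_b: "\<And>k. int p dvd snd b k - (snd da k + snd db k + snd dc k + 2 * dab k + 2 * dac k + 2 * dbc k)"
  shows "tw_norm8 p n rs Ms f da db dc dab dac dbc =
    (N ^ 2 / real (card (qpre p n Ms dab))) ^ 4 * (N ^ 2 / real (card (qpre p n Ms dac))) ^ 4 * (N ^ 2 / real (card (qpre p n Ms dbc))) ^ 4
    / (real (card (atom p n rs Ms da)) ^ 2 * real (card (atom p n rs Ms db)) ^ 2 * real (card (atom p n rs Ms dc)) ^ 2)
    * (\<Sum>x\<in>V. \<Sum>h1\<in>V. \<Sum>h2\<in>V. \<Sum>h3\<in>V. of_bool (parallelepiped b x h1 h2 h3) * cube_prod p n f x h1 h2 h3 *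
        (\<Sum>v\<in>V. \<Sum>w\<in>V. of_bool (base_point da (\<lambda>k. snd da k + dab k + dac k) x h1 h2 h3 v)
           * of_bool (base_point db (\<lambda>k. snd db k + dab k + dbc k) x h2 h1 h3 w \<and> inQ dab w v)))"
proof -
  define kab where "kab = N ^ 2 / real (card (qpre p n Ms dab))"
  define kac where "kac = N ^ 2 / real (card (qpre p n Ms dac))"
  define kbc where "kbc = N ^ 2 / real (card (qpre p n Ms dbc))"
  let ?A = "atom p n rs Ms da" and ?B = "atom p n rs Ms db" and ?D = "atom p n rs Ms dc"
  define \<kappa> where "\<kappa> = kab ^ 4 * kac ^ 4 * kbc ^ 4"
  let ?G = "\<lambda>x1 x2 y1 y2 z1 z2. of_bool (octahedral da db dc dab dac dbc x1 x2 y1 y2 z1 z2) * sum_prod f x1 x2 y1 y2 z1 z2"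
  define body where "body x1 x2 y1 y2 z1 z2 =
        (let X = (\<lambda>i::nat. if i = 1 then x1 else x2);
             Y = (\<lambda>i::nat. if i = 1 then y1 else y2);
             Z = (\<lambda>i::nat. if i = 1 then z1 else z2) in
         (\<Prod>i\<in>{1,2}. \<Prod>j\<in>{1,2}.
             mu p n (qpre p n Ms dab) (X i) (Y j) * mu p n (qpre p n Ms dac) (X i) (Z j) * mu p n (qpre p n Ms dbc) (Y i) (Z j)) *
         (\<Prod>i\<in>{1,2}. \<Prod>j\<in>{1,2}. \<Prod>k\<in>{1,2}. f (vadd p (vadd p (X i) (Y j)) (Z k))))"
    for x1 x2 y1 y2 z1 z2
  have sub: "?A \<subseteq> V" "?B \<subseteq> V" "?D \<subseteq> V" by (auto simp: atom_def)
  \<comment> \<open>Atoms are not translation invariant, so their sums become weighted sums over all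
    of \<open>V\<close> before the substitution.\<close>
  note subs = sum_subset_of_bool[OF finite_Vn sub(1)] sum_subset_of_bool[OF finite_Vn sub(2)] sum_subset_of_bool[OF finite_Vn sub(3)]
  have body_eq: "of_bool (x1 \<in> ?A) * (of_bool (x2 \<in> ?A) * (of_bool (y1 \<in> ?B) * (of_bool (y2 \<in> ?B) * (of_bool (z1 \<in> ?D) *
      (of_bool (z2 \<in> ?D) * body x1 x2 y1 y2 z1 z2))))) = \<kappa> * ?G x1 x2 y1 y2 z1 z2"
    if "x1 \<in> V" "x2 \<in> V" "y1 \<in> V" "y2 \<in> V" "z1 \<in> V" "z2 \<in> V" for x1 x2 y1 y2 z1 z2
  proof -
    have "body x1 x2 y1 y2 z1 z2 =
       (kab * of_bool (inQ dab x1 y1) * (kac * of_bool (inQ dac x1 z1)) * (kbc * of_bool (inQ dbc y1 z1))) *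
       (kab * of_bool (inQ dab x1 y2) * (kac * of_bool (inQ dac x1 z2)) * (kbc * of_bool (inQ dbc y1 z2))) *
       (kab * of_bool (inQ dab x2 y1) * (kac * of_bool (inQ dac x2 z1)) * (kbc * of_bool (inQ dbc y2 z1))) *
       (kab * of_bool (inQ dab x2 y2) * (kac * of_bool (inQ dac x2 z2)) * (kbc * of_bool (inQ dbc y2 z2))) *
       sum_prod f x1 x2 y1 y2 z1 z2"
      using that by (simp add: body_def Let_def mu_eq[OF e(1)] mu_eq[OF e(2)] mu_eq[OF e(3)] kab_def kac_def kbc_def sum_prod_def mult_ac)
    moreover have power4: "k ^ 4 = k * k * k * k" for k :: real by (simp add: eval_nat_numeral)
    ultimately show ?thesis
      using that
      by (simp only: atom_iff[OF d(1)] atom_iff[OF d(2)] atom_iff[OF d(3)] octahedral_def of_bool_conj \<kappa>_def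
          power4 mult_1_right simp_thms True_implies_equals)
        (simp only: of_bool_eq mult_1 mult_1_right mult_ac)
  qed
  have "(\<Sum>x1\<in>?A. \<Sum>x2\<in>?A. \<Sum>y1\<in>?B. \<Sum>y2\<in>?B. \<Sum>z1\<in>?D. \<Sum>z2\<in>?D. body x1 x2 y1 y2 z1 z2)
    = (\<Sum>x1\<in>V. \<Sum>x2\<in>V. \<Sum>y1\<in>V. \<Sum>y2\<in>V. \<Sum>z1\<in>V. \<Sum>z2\<in>V. \<kappa> * ?G x1 x2 y1 y2 z1 z2)"
    unfolding subs unfolding sum_distrib_left by (intro sum.cong refl body_eq)
  also have "\<dots> = \<kappa> * (\<Sum>x1\<in>V. \<Sum>x2\<in>V. \<Sum>y1\<in>V. \<Sum>y2\<in>V. \<Sum>z1\<in>V. \<Sum>z2\<in>V. ?G x1 x2 y1 y2 z1 z2)"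
    by (simp only: sum_distrib_left)
  also have "(\<Sum>x1\<in>V. \<Sum>x2\<in>V. \<Sum>y1\<in>V. \<Sum>y2\<in>V. \<Sum>z1\<in>V. \<Sum>z2\<in>V. ?G x1 x2 y1 y2 z1 z2)
     = (\<Sum>x\<in>V. \<Sum>h1\<in>V. \<Sum>h2\<in>V. \<Sum>h3\<in>V. of_bool (parallelepiped b x h1 h2 h3) * cube_prod p n f x h1 h2 h3 *
        (\<Sum>v\<in>V. \<Sum>w\<in>V. of_bool (base_point da (\<lambda>k. snd da k + dab k + dac k) x h1 h2 h3 v)
           * of_bool (base_point db (\<lambda>k. snd db k + dab k + dbc k) x h2 h1 h3 w \<and> inQ dab w v)))"
    unfolding sum_reparametrize[of ?G] unfolding sum_distrib_left
  proof (intro sum.cong refl)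
    fix x h1 h2 h3 v w assume "v \<in> V" "w \<in> V"
    have red: "octahedral da db dc dab dac dbc v (red p n (h1 + v)) w (red p n (h2 + w)) (red p n (x - (v + w))) (red p n (h3 + (x - (v + w))))
       \<longleftrightarrow> octahedral da db dc dab dac dbc v (h1 + v) w (h2 + w) (x - (v + w)) (h3 + (x - (v + w)))"
      unfolding octahedral_def inB_red inQ_red_left inQ_red_right ..
    show "?G v (red p n (h1 + v)) w (red p n (h2 + w)) (red p n (x - (v + w))) (red p n (h3 + (x - (v + w))))
      = of_bool (parallelepiped b x h1 h2 h3) * cube_prod p n f x h1 h2 h3 *
        (of_bool (base_point da (\<lambda>k. snd da k + dab k + dac k) x h1 h2 h3 v)
           * of_bool (base_point db (\<lambda>k. snd db k + dab k + dbc k) x h2 h1 h3 w \<and> inQ dab w v))"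
      unfolding red octahedral_iff[OF fst_b snd_b] sum_prod_eq_cube_prod[OF \<open>v \<in> V\<close> \<open>w \<in> V\<close>] of_bool_conj
      by (simp only: mult_ac)
  qed
  finally have "tw_norm8 p n rs Ms f da db dc dab dac dbc
      = \<kappa> * (\<Sum>x\<in>V. \<Sum>h1\<in>V. \<Sum>h2\<in>V. \<Sum>h3\<in>V. of_bool (parallelepiped b x h1 h2 h3) * cube_prod p n f x h1 h2 h3 *
        (\<Sum>v\<in>V. \<Sum>w\<in>V. of_bool (base_point da (\<lambda>k. snd da k + dab k + dac k) x h1 h2 h3 v)
           * of_bool (base_point db (\<lambda>k. snd db k + dab k + dbc k) x h2 h1 h3 w \<and> inQ dab w v)))
       / (real (card ?A) ^ 2 * real (card ?B) ^ 2 * real (card ?D) ^ 2)"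
    by (simp only: tw_norm8_def Let_def body_def)
  then show ?thesis
    by (simp only: \<kappa>_def kab_def kac_def kbc_def times_divide_eq_left)
qed

end

section \<open>Comparison of the two norms\<close>

lemma Sigma_d_dvd:
  assumes "Sigma_d p da db dc dab dac dbc = b"
  shows "int p dvd fst b k - (fst da k + fst db k + fst dc k)"
    and "int p dvd snd b k - (snd da k + snd db k + snd dc k + 2 * dab k + 2 * dac k + 2 * dbc k)"
proof -
  have "fst b k mod int p = (fst da k + fst db k + fst dc k) mod int p"
    unfolding assms[symmetric] by (simp add: Sigma_d_def padd_def vadd_def mod_simps)
  then show "int p dvd fst b k - (fst da k + fst db k + fst dc k)" by (simp add: mod_eq_dvd_iff)
  have "snd b k mod int p = (snd da k + snd db k + snd dc k + 2 * dab k + 2 * dac k + 2 * dbc k) mod int p"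
    unfolding assms[symmetric] by (simp add: Sigma_d_def padd_def vadd_def smul_def mod_simps)
  then show "int p dvd snd b k - (snd da k + snd db k + snd dc k + 2 * dab k + 2 * dac k + 2 * dbc k)"
    by (simp add: mod_eq_dvd_iff)
qed

lemma scaled_deviation:
  fixes M c :: real
  assumes "M > 0" "c > 0" "\<bar>y - M / c\<bar> \<le> t * M"
  shows "\<bar>y * c / M - 1\<bar> \<le> c * t"
proof -
  have "y * c / M - 1 = (y - M / c) * (c / M)" using assms by (simp add: field_simps)
  then have "\<bar>y * c / M - 1\<bar> = \<bar>y - M / c\<bar> * (c / M)" using assms by (simp add: abs_mult)
  also have "\<dots> \<le> t * M * (c / M)" using assms by (intro mult_right_mono) auto
  also have "\<dots> = c * t" using assms by simp
  finally show ?thesis .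
qed

lemma sum4_abs_le:
  fixes G H :: "'a \<Rightarrow> 'a \<Rightarrow> 'a \<Rightarrow> 'a \<Rightarrow> real"
  assumes "\<And>x y z w. \<bar>G x y z w\<bar> \<le> H x y z w"
  shows "\<bar>\<Sum>x\<in>A. \<Sum>y\<in>A. \<Sum>z\<in>A. \<Sum>w\<in>A. G x y z w\<bar> \<le> (\<Sum>x\<in>A. \<Sum>y\<in>A. \<Sum>z\<in>A. \<Sum>w\<in>A. H x y z w)"
  by (rule order_trans[OF sum_abs], rule sum_mono)+ (rule assms)

context quadratic_factor
begin

text \<open>Every count is rescaled to have expected size 1. This multiplies an error by a power of
  \<open>p\<close> with exponent at most \<open>6 l + 18 q \<le> 18 (l + q)\<close>, and the largest
  numerical factor, 4, comes from \<open>count_parallelepipeds\<close>; hence the form of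
  \<tau>.\<close>

lemma local_norms_close:
  assumes d: "da \<in> Vn p l \<times> Vn p q" "db \<in> Vn p l \<times> Vn p q" "dc \<in> Vn p l \<times> Vn p q"
    and e: "dab \<in> Vn p q" "dac \<in> Vn p q" "dbc \<in> Vn p q" and b: "b \<in> Vn p l \<times> Vn p q"
    and sig: "Sigma_d p da db dc dab dac dbc = b" and f: "\<forall>x\<in>V. \<bar>f x\<bar> \<le> 1"
    and \<tau>_def: "\<tau> = 4 * real p ^ (18 * (l + q)) * \<delta>" and small: "36 * \<tau> \<le> 1"
  shows "\<bar>tw_norm8 p n rs Ms f da db dc dab dac dbc - prend_norm p n rs Ms f b ^ 8\<bar> \<le> 80 * \<tau>"
proof -
  let ?P = "real p"
  have P1: "1 \<le> ?P" and P0: "0 < ?P" using p_pos by auto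
  have \<tau>0: "0 \<le> \<tau>" unfolding \<tau>_def using \<delta>_nonneg by simp
  have le: "?P ^ m * t \<le> \<tau>" if "m \<le> 18 * (l + q)" "t \<le> 4 * \<delta>" "0 \<le> t" for m t
  proof -
    have "?P ^ m * t \<le> ?P ^ (18 * (l + q)) * (4 * \<delta>)"
      using that P1 by (intro mult_mono power_increasing) auto
    then show ?thesis by (simp add: \<tau>_def mult_ac)
  qed
  define A where "A d = real (card (atom p n rs Ms d)) * ?P ^ (l + q) / N" for d
  define g where "g u = real (card (qpre p n Ms u)) * ?P ^ q / N ^ 2" for u
  have A: "\<bar>A d - 1\<bar> \<le> \<tau>" if "d \<in> Vn p l \<times> Vn p q" for d
  proof -
    have "\<bar>A d - 1\<bar> \<le> ?P ^ (l + q) * \<delta>"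
      unfolding A_def by (rule scaled_deviation) (use N_pos P0 card_atom[OF that] in auto)
    then show ?thesis using le[of "l + q" \<delta>] \<delta>_nonneg by simp
  qed
  have g: "\<bar>g u - 1\<bar> \<le> \<tau>" if "u \<in> Vn p q" for u
  proof -
    have "\<bar>g u - 1\<bar> \<le> ?P ^ q * \<delta>"
      unfolding g_def by (rule scaled_deviation) (use N_pos P0 card_qpre[OF that] in auto)
    then show ?thesis using le[of q \<delta>] \<delta>_nonneg by simp
  qed
  define U where "U = u3_sum p n (indicator (atom p n rs Ms b))"
  define u where "u = U * ?P ^ (4 * l + 7 * q) / N ^ 4"
  have "\<nu> 0 * \<nu> 0 * \<nu> 1 * \<nu> 2 = N ^ 4 / ?P ^ ((l + q) + (l + q) + (l + 2 * q) + (l + 3 * q))"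
    unfolding \<nu>_def power_add by (simp add: eval_nat_numeral)
  also have "(l + q) + (l + q) + (l + 2 * q) + (l + 3 * q) = 4 * l + 7 * q" by simp
  finally have "\<bar>U - N ^ 4 / ?P ^ (4 * l + 7 * q)\<bar> \<le> 4 * \<delta> * N ^ 4"
    using count_parallelepipeds[of b] unfolding U_def u3_sum_atom[OF b] by (simp only:)
  then have "\<bar>u - 1\<bar> \<le> ?P ^ (4 * l + 7 * q) * (4 * \<delta>)"
    unfolding u_def using N_pos P0 by (intro scaled_deviation) auto
  then have u: "\<bar>u - 1\<bar> \<le> \<tau>" using le[of "4 * l + 7 * q" "4 * \<delta>"] \<delta>_nonneg by simp
  then have "u > 0" using small \<tau>0 by linarith
  then have U0: "U > 0" using N_pos P0 by (simp add: u_def zero_less_divide_iff zero_less_mult_iff)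
  define F where "F x h1 h2 h3 = of_bool (parallelepiped b x h1 h2 h3) * cube_prod p n f x h1 h2 h3" for x h1 h2 h3
  define c where "c x h1 h2 h3 = (\<Sum>v\<in>V. \<Sum>w\<in>V. of_bool (base_point da (\<lambda>k. snd da k + dab k + dac k) x h1 h2 h3 v)
           * of_bool (base_point db (\<lambda>k. snd db k + dab k + dbc k) x h2 h1 h3 w \<and> inQ dab w v) :: real)" for x h1 h2 h3
  define S where "S = (\<Sum>x\<in>V. \<Sum>h1\<in>V. \<Sum>h2\<in>V. \<Sum>h3\<in>V. F x h1 h2 h3 * c x h1 h2 h3)"
  define S0 where "S0 = (\<Sum>x\<in>V. \<Sum>h1\<in>V. \<Sum>h2\<in>V. \<Sum>h3\<in>V. F x h1 h2 h3)"
  have F1: "\<bar>F x h1 h2 h3\<bar> \<le> of_bool (parallelepiped b x h1 h2 h3)" for x h1 h2 h3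
    unfolding F_def using abs_cube_prod_le_1[OF p_pos f] by simp
  have S0U: "\<bar>S0\<bar> \<le> U"
    unfolding S0_def U_def u3_sum_atom[OF b] by (rule sum4_abs_le) (rule F1)
  have prend: "prend_norm p n rs Ms f b ^ 8 = S0 / U"
    using prend_norm_pow8[of b f] U0 unfolding U_def S0_def F_def u3_sum_local[OF b] by blast
  have diff: "S - \<nu> 4 * \<nu> 5 * S0 = (\<Sum>x\<in>V. \<Sum>h1\<in>V. \<Sum>h2\<in>V. \<Sum>h3\<in>V. F x h1 h2 h3 * c x h1 h2 h3 - \<nu> 4 * \<nu> 5 * F x h1 h2 h3)"
    by (simp only: S_def S0_def sum_distrib_left sum_subtractf)
  have "\<bar>S - \<nu> 4 * \<nu> 5 * S0\<bar> \<le> (\<Sum>x\<in>V. \<Sum>h1\<in>V. \<Sum>h2\<in>V. \<Sum>h3\<in>V. \<bar>c x h1 h2 h3 - \<nu> 4 * \<nu> 5\<bar>)"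
    unfolding diff
  proof (rule sum4_abs_le)
    fix x h1 h2 h3
    have "\<bar>F x h1 h2 h3\<bar> \<le> 1" using F1[of x h1 h2 h3] by (simp add: of_bool_def split: if_splits)
    then have "\<bar>F x h1 h2 h3 * (c x h1 h2 h3 - \<nu> 4 * \<nu> 5)\<bar> \<le> \<bar>c x h1 h2 h3 - \<nu> 4 * \<nu> 5\<bar>"
      unfolding abs_mult by (intro mult_left_le_one_le) auto
    then show "\<bar>F x h1 h2 h3 * c x h1 h2 h3 - \<nu> 4 * \<nu> 5 * F x h1 h2 h3\<bar> \<le> \<bar>c x h1 h2 h3 - \<nu> 4 * \<nu> 5\<bar>"
      by (simp add: right_diff_distrib mult.commute)
  qed
  also have "\<dots> \<le> 2 * \<delta> * N ^ 6"
    unfolding c_def by (rule count_decompositions)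
  finally have SS: "\<bar>S - \<nu> 4 * \<nu> 5 * S0\<bar> \<le> 2 * \<delta> * N ^ 6" .
  \<comment> \<open>\<open>R\<close> and \<open>T\<close> are the two numerators divided by the
    expected numbers of octahedra and of parallelepipeds, whose ratio is exactly
    \<open>\<nu> 4 * \<nu> 5\<close>.\<close>
  define R where "R = ?P ^ (6 * l + 18 * q) / N ^ 6 * S"
  define T where "T = ?P ^ (4 * l + 7 * q) / N ^ 4 * S0"
  have "\<nu> 4 * \<nu> 5 = N ^ 2 / ?P ^ (2 * l + 11 * q)"
  proof -
    have "\<nu> 4 * \<nu> 5 = N ^ 2 / ?P ^ ((l + 5 * q) + (l + 6 * q))"
      unfolding \<nu>_def power_add by (simp add: power2_eq_square)
    also have "(l + 5 * q) + (l + 6 * q) = 2 * l + 11 * q" by simp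
    finally show ?thesis .
  qed
  then have "?P ^ (6 * l + 18 * q) / N ^ 6 * (\<nu> 4 * \<nu> 5) = ?P ^ ((4 * l + 7 * q) + (2 * l + 11 * q)) / N ^ (4 + 2) * (N ^ 2 / ?P ^ (2 * l + 11 * q))"
    by simp
  also have "\<dots> = ?P ^ (4 * l + 7 * q) / N ^ 4"
  proof -
    have cancel: "(a * b) / (c * d) * (d / b) = a / c" if "b \<noteq> 0" "d \<noteq> 0" for a b c d :: real
      using that by simp
    show ?thesis
      unfolding power_add[of ?P "4 * l + 7 * q"] power_add[of N 4]
      by (rule cancel) (use P0 in simp_all)
  qed
  finally have "R - T = ?P ^ (6 * l + 18 * q) / N ^ 6 * (S - \<nu> 4 * \<nu> 5 * S0)"
    unfolding R_def T_def right_diff_distrib by (simp only: mult.assoc[symmetric])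
  then have "\<bar>R - T\<bar> = ?P ^ (6 * l + 18 * q) / N ^ 6 * \<bar>S - \<nu> 4 * \<nu> 5 * S0\<bar>"
    using N_pos P0 by (simp add: abs_mult)
  also have "\<dots> \<le> ?P ^ (6 * l + 18 * q) / N ^ 6 * (2 * \<delta> * N ^ 6)"
    using SS by (intro mult_left_mono) auto
  also have "\<dots> = ?P ^ (6 * l + 18 * q) * (2 * \<delta>)" using p_pos by simp
  also have "\<dots> \<le> \<tau>" using \<delta>_nonneg by (intro le) auto
  finally have RT: "\<bar>R - T\<bar> \<le> \<tau>" .
  have Tu: "\<bar>T\<bar> \<le> u"
    using mult_left_mono[OF S0U, of "?P ^ (4 * l + 7 * q) / N ^ 4"] by (simp add: T_def u_def abs_mult mult_ac)
  have TU: "S0 / U = T / u"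
    using N_pos P0 by (simp add: T_def u_def)
  have Gm: "N ^ 2 / real (card (qpre p n Ms v)) = ?P ^ q / g v" for v
    using P0 N_pos by (simp add: g_def)
  have Am: "real (card (atom p n rs Ms d)) = A d * (N / ?P ^ (l + q))" for d
    using P0 N_pos by (simp add: A_def)
  have "tw_norm8 p n rs Ms f da db dc dab dac dbc =
      (?P ^ q / g dab) ^ 4 * (?P ^ q / g dac) ^ 4 * (?P ^ q / g dbc) ^ 4
      / ((A da * (N / ?P ^ (l + q))) ^ 2 * (A db * (N / ?P ^ (l + q))) ^ 2 * (A dc * (N / ?P ^ (l + q))) ^ 2) * S"
    using tw_norm8_eq[OF d e Sigma_d_dvd[OF sig], of f] unfolding Gm Am S_def F_def c_def .
  also have "\<dots> = R / (g dab ^ 4 * g dac ^ 4 * g dbc ^ 4 * A da ^ 2 * A db ^ 2 * A dc ^ 2)"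
  proof -
    \<comment> \<open>Twelve pair densities and six atom densities:
      \<open>12 q + 6 (l + q) = 6 l + 18 q\<close>.\<close>
    have "(?P ^ q) ^ 12 * (?P ^ (l + q)) ^ 6 = ?P ^ (6 * l + 18 * q)"
      unfolding power_mult[symmetric] power_add[symmetric] by (rule arg_cong[of _ _ "(^) ?P"]) simp
    moreover have "(Y / g1) ^ 4 * (Y / g2) ^ 4 * (Y / g3) ^ 4
        / ((a1 * (N / Z)) ^ 2 * (a2 * (N / Z)) ^ 2 * (a3 * (N / Z)) ^ 2) * S
        = (Y ^ 12 * Z ^ 6) / N ^ 6 * S / (g1 ^ 4 * g2 ^ 4 * g3 ^ 4 * a1 ^ 2 * a2 ^ 2 * a3 ^ 2)" if "Z \<noteq> 0" for Y Z g1 g2 g3 a1 a2 a3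
    proof -
      have "(Y / g1) ^ 4 * (Y / g2) ^ 4 * (Y / g3) ^ 4 = Y ^ 12 / (g1 ^ 4 * g2 ^ 4 * g3 ^ 4)"
        by (simp add: power_divide flip: power_add)
      moreover have "(a1 * (N / Z)) ^ 2 * (a2 * (N / Z)) ^ 2 * (a3 * (N / Z)) ^ 2 = N ^ 6 / Z ^ 6 * (a1 ^ 2 * a2 ^ 2 * a3 ^ 2)"
        by (simp add: power_mult_distrib power_divide eval_nat_numeral mult_ac)
      ultimately show ?thesis using N_pos that by (simp add: mult_ac)
    qed
    ultimately show ?thesis unfolding R_def using P0 by (metis power_not_zero less_irrefl)
  qed
  finally show ?thesis
    unfolding prend TU
    using normalized_difference_bound[OF \<tau>0 small g[OF e(1)] g[OF e(2)] g[OF e(3)] A[OF d(1)] A[OF d(2)] A[OF d(3)] u Tu RT]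
    by (simp only:)
qed

text \<open>Origin of 48: for a nontrivial factor the constant \<open>80 * 4 = 320\<close> is below
  \<open>3 ^ 6\<close>, hence at most \<open>p ^ (6 (l + q))\<close>, and raises the exponent 18 to
  24; \<delta> is \<open>p\<close> to minus half the rank, which doubles it.\<close>

lemma deviation_le_epsilon:
  assumes \<epsilon>: "0 < \<epsilon>" "\<epsilon> < 1"
    and rk: "real (qf_rank p n Ms) \<ge> 48 * (real l + real q + log (real p) (1 / \<epsilon>))"
  shows "80 * (4 * real p ^ (18 * (l + q)) * \<delta>) \<le> \<epsilon>"
proof (cases "l + q = 0")
  case True
  have "\<delta> = 0" unfolding \<delta>_def by (rule if_P) (rule True)
  then show ?thesis using \<epsilon> by simp
next
  case False
  let ?P = "real p" and ?s = "l + q"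
  have P: "?P \<ge> 3" using p_ge_3 by simp
  have six: "6 \<le> 6 * ?s" using False by presburger
  have "(320::real) \<le> 3 ^ 6" by simp
  also have "\<dots> \<le> ?P ^ 6" using P by (intro power_mono) auto
  also have "\<dots> \<le> ?P ^ (6 * ?s)" using P six by (intro power_increasing) auto
  finally have "320 * (?P ^ (18 * ?s) * \<delta>) \<le> ?P ^ (6 * ?s) * (?P ^ (18 * ?s) * \<delta>)"
    using \<delta>_nonneg by (intro mult_right_mono) auto
  then have "80 * (4 * ?P ^ (18 * ?s) * \<delta>) \<le> ?P ^ (6 * ?s) * ?P ^ (18 * ?s) * \<delta>"
    by (simp only: mult.assoc)
  also have "\<dots> = ?P ^ (24 * ?s) * \<delta>" by (simp flip: power_add)
  also have "\<dots> = ?P powr (24 * real ?s) * ?P powr (- (real (qf_rank p n Ms) / 2))"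
    using P False powr_realpow[of ?P "24 * ?s"] by (simp add: \<delta>_def)
  also have "\<dots> = ?P powr (24 * real ?s - real (qf_rank p n Ms) / 2)"
    by (simp flip: powr_add)
  also have "\<dots> \<le> ?P powr (- log ?P (1 / \<epsilon>))"
  proof (rule powr_mono)
    have "0 \<le> log ?P (1 / \<epsilon>)" using P \<epsilon> by simp
    then show "24 * real ?s - real (qf_rank p n Ms) / 2 \<le> - log ?P (1 / \<epsilon>)"
      using rk by simp
  qed (use P in simp)
  also have "\<dots> = \<epsilon>"
    using P \<epsilon> by (simp add: powr_minus)
  finally show ?thesis .
qed

end

theorem mainTheorem3:
  shows "\<exists>C::real. C > 0 \<and>
    (\<forall>(p::nat) (n::nat) (\<epsilon>::real) rs Ms b da db dc dab dac dbc (f :: (nat \<Rightarrow> int) \<Rightarrow> real).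
       prime p \<and> odd p \<and> 0 < \<epsilon> \<and> \<epsilon> < 1 \<and>
       is_linear_factor p n rs \<and> is_pquad_factor p n Ms \<and>
       real (qf_rank p n Ms) \<ge> C * (real (length rs) + real (length Ms) + log (real p) (1 / \<epsilon>)) \<and>
       b \<in> Vn p (length rs) \<times> Vn p (length Ms) \<and>
       da \<in> Vn p (length rs) \<times> Vn p (length Ms) \<and>
       db \<in> Vn p (length rs) \<times> Vn p (length Ms) \<and>
       dc \<in> Vn p (length rs) \<times> Vn p (length Ms) \<and>
       dab \<in> Vn p (length Ms) \<and> dac \<in> Vn p (length Ms) \<and> dbc \<in> Vn p (length Ms) \<and>
       Sigma_d p da db dc dab dac dbc = b \<and>
       (\<forall>x\<in>Vn p n. \<bar>f x\<bar> \<le> 1)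
       \<longrightarrow> \<bar>tw_norm8 p n rs Ms f da db dc dab dac dbc - (prend_norm p n rs Ms f b) ^ 8\<bar> \<le> \<epsilon>)"
proof (intro exI[of _ 48] conjI allI impI; (elim conjE)?)
  fix p n \<epsilon> rs Ms b da db dc dab dac dbc and f :: "(nat \<Rightarrow> int) \<Rightarrow> real"
  assume "prime p" "odd p" "is_linear_factor p n rs" "is_pquad_factor p n Ms"
    and \<epsilon>: "0 < \<epsilon>" "\<epsilon> < 1"
      "real (qf_rank p n Ms) \<ge> 48 * (real (length rs) + real (length Ms) + log (real p) (1 / \<epsilon>))"
    and d: "b \<in> Vn p (length rs) \<times> Vn p (length Ms)"
      "da \<in> Vn p (length rs) \<times> Vn p (length Ms)"
      "db \<in> Vn p (length rs) \<times> Vn p (length Ms)"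
      "dc \<in> Vn p (length rs) \<times> Vn p (length Ms)"
      "dab \<in> Vn p (length Ms)" "dac \<in> Vn p (length Ms)" "dbc \<in> Vn p (length Ms)"
      "Sigma_d p da db dc dab dac dbc = b" "\<forall>x\<in>Vn p n. \<bar>f x\<bar> \<le> 1"
  then interpret quadratic_factor p n rs Ms by unfold_locales
  note le = deviation_le_epsilon[OF \<epsilon>]
  have "36 * (4 * real p ^ (18 * (length rs + length Ms)) * \<delta>) \<le> 1"
    using le \<epsilon> \<delta>_nonneg by linarith
  from local_norms_close[OF d(2-7,1,8,9) refl this] le
  show "\<bar>tw_norm8 p n rs Ms f da db dc dab dac dbc - (prend_norm p n rs Ms f b) ^ 8\<bar> \<le> \<epsilon>"
    by linarith
qed simp

end
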